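(* Let $X,Y$ be metric spaces and $E,F$ nontrivial normed spaces. Suppose that $A(X,E)$ is a standard subspace of $U(X,E)$ that contains a nonzero constant function, and assume that $A(X,E)$ has property (P). Let $A(Y,F)=C(Y,F)$ or $C_*(Y,F)$. Let $T:A(X,E)\to A(Y,F)$ be a biseparating map with $T0=0$, and let $\varphi:X\to Y$ and $\psi:Y\to\widetilde{X}$ be the maps associated with $T$. Then: (1) For any $y\in Y$, there is a function $\Phi(y,\cdot):\widetilde{E}_{\psi(y)}\to F$ such that $Tf(y)=\Phi(y,\widetilde{f}(\psi(y)))$ for all $f\in A(X,E)$. (2) There is a function $\Psi:X\times F\to E$ such that $T^{-1}g(x)=\Psi(x,g(\varphi(x)))$ for all $g\in A(Y,F)$ and all $x\in X$.
   Context: $U(X,E)$ is the space of uniformly continuous functions $X\to E$; $C(Y,F)$ the continuous functions and $C_*(Y,F)$ the bounded continuous functions $Y\to F$. $\widetilde{X},\widetilde{Y},\widetilde{E}$ are the completions of $X,Y,E$; for a subset $U$ of $X$, $\widetilde{U}$ denotes its closure in $\widetilde{X}$, and $\overline{U}$ its closure in $X$. Each $f\in A(X,E)\subseteq U(X,E)$ has a unique continuous extension $\widetilde{f}:\widetilde{X}\to\widetilde{E}$; for $x\in\widetilde{X}$ put $\widetilde{E}_x=\{\widetilde{f}(x): f\in A(X,E)\}$. For $f\in A(X,E)$ let $C(f)=\{x: f(x)\neq 0\}$, $\mathcal{C}(X)=\{C(f): f\in A(X,E)\}$, $\widehat{C}(f)=X\setminus\bigcup\{C\in\mathcal{C}(X):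 C\cap C(f)=\emptyset\}$, $\mathcal{D}(X)=\{\widehat{C}(f): f\in A(X,E)\}$; similarly for $Y$. Write $f\perp_h g$ if $C(f-h)\cap C(g-h)=\emptyset$. A map $T$ (not assumed linear) between function spaces is biseparating if it is a bijection and for all $f,g,h$ in its domain: $f\perp_h g\iff Tf\perp_{Th}Tg$. A vector subspace $A(X,E)$ of $C(X,E)$ is standard if: (S1) for any $f\in A(X,E)$, $D\in\mathcal{D}(X)$ and $x\notin D$ there are $g\in A(X,E)$ and $C\in\mathcal{C}(X)$ with $x\in C$, $g=f$ on $C$, $g=0$ on $D$; (S2) for any $x\in X$ and $\varepsilon>0$ there is $C\in\mathcal{C}(X)$ with $x\in C$ and $\operatorname{diam}C<\varepsilon$ (it follows that $\widehat{C}(f)=\overline{C(f)}$ for all $f\in A(X,E)$); (S3) if $f\in A(X,E)$ and $(x_n)$ is a sequence in $X$ with $\inf_{n\neq m}d(x_n,x_m)>0$, there are a sequence $(C_n)$ in $\mathcal{C}(X)$ and $g\in A(X,E)$ such that $x_n\in C_n$ for all $n$, $g=f$ on $C_n$ for infinitely many $n$ and $g=0$ on $C_n$ for infinitely many $n$; (S4) if $(x_n),(x_n')$ are Cauchy sequences in $X$ with $\inf_{m,n}d(x_m,x_n')>0$ and $f\in A(X,E)$, there are $U,V\in\mathcal{C}(X)$ and $g\in A(X,E)$ with $x_n\in U$ and $x_n'\in V$ for infinitely many $n$, $g=f$ on $U$ and $g=0$ on $V$. Property (P): for any accumulation point $x$ of $\widetilde{X}$ and any $f\in A(X,E)$ with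 $\lim_{z\to x,\,z\in X}f(z)=0$, there are open sets $U,V$ in $X$ and $g\in A(X,E)$ such that $x\in\widetilde{U}\cap\widetilde{V}$, $g=f$ on $U$ and $g=0$ on $V$. Associated maps: since $T0=0$, $T$ induces a well-defined inclusion-preserving bijection $\theta:\mathcal{D}(X)\to\mathcal{D}(Y)$, $\theta(\widehat{C}(h))=\widehat{C}(Th)$. For $x\in\widetilde{X}$ and nonempty $U_n\in\mathcal{C}(X)$, write $(U_n)\sim x$ if $\operatorname{diam}U_n\to0$ and $d(x,U_n)\to0$; similarly in $Y$. For $x\in X$, $\varphi(x)=\lim y_n$ where $(U_n)\sim x$ and $y_n\in\theta(\overline{U_n})$; for $y\in Y$, $\psi(y)=\lim x_n\in\widetilde{X}$ where $(V_n)\sim y$ ($V_n\in\mathcal{C}(Y)$ nonempty) and $x_n\in\theta^{-1}(\overline{V_n})$. The paper shows these limits exist independently of choices and that $\varphi(X)\subseteq Y$. *)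

theory Defs
  imports "HOL-Analysis.Analysis"
begin

text \<open>
  Metric spaces are types of class \<^class>\<open>metric_space\<close>, and a function space is a set of
  functions. Scalars are real; a complex normed space is covered by forgetting the complex
  structure, since a complex subspace is a real subspace and no map below is assumed linear.
\<close>

definition is_completion :: "('a::metric_space \<Rightarrow> 'c::complete_space) \<Rightarrow> bool" where
  "is_completion i \<longleftrightarrow> (\<forall>x y. dist (i x) (i y) = dist x y) \<and> closure (range i) = UNIV"

text \<open>The continuous extension of \<open>f\<close> to the completions \<open>i\<close> of its domain and \<open>j\<close> of its
  codomain; it exists and is unique if \<open>f\<close> is uniformly continuous.\<close>

definition extend ::
  "('x::metric_space \<Rightarrow> 'xc::complete_space) \<Rightarrow> ('e::metric_space \<Rightarrow> 'ec::complete_space)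
    \<Rightarrow> ('x \<Rightarrow> 'e) \<Rightarrow> 'xc \<Rightarrow> 'ec" where
  "extend i j f = (THE h. continuous_on UNIV h \<and> (\<forall>x. h (i x) = j (f x)))"

definition ext_values ::
  "('x::metric_space \<Rightarrow> 'xc::complete_space) \<Rightarrow> ('e::metric_space \<Rightarrow> 'ec::complete_space)
    \<Rightarrow> ('x \<Rightarrow> 'e) set \<Rightarrow> 'xc \<Rightarrow> 'ec set" where
  "ext_values i j A x = {extend i j f x | f. f \<in> A}"

definition coz :: "('x \<Rightarrow> 'e::zero) \<Rightarrow> 'x set" where
  "coz f = {x. f x \<noteq> 0}"

definition coz_sets :: "('x \<Rightarrow> 'e::zero) set \<Rightarrow> 'x set set" where
  "coz_sets A = {coz f | f. f \<in> A}"

definition hat_coz :: "('x \<Rightarrow> 'e::zero) set \<Rightarrow> ('x \<Rightarrow> 'e) \<Rightarrow> 'x set" where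
  "hat_coz A f = UNIV - \<Union>{C \<in> coz_sets A. C \<inter> coz f = {}}"

definition hat_coz_sets :: "('x \<Rightarrow> 'e::zero) set \<Rightarrow> 'x set set" where
  "hat_coz_sets A = {hat_coz A f | f. f \<in> A}"

definition perp :: "('x \<Rightarrow> 'e::group_add) \<Rightarrow> ('x \<Rightarrow> 'e) \<Rightarrow> ('x \<Rightarrow> 'e) \<Rightarrow> bool" where
  "perp h f g \<longleftrightarrow> coz (\<lambda>x. f x - h x) \<inter> coz (\<lambda>x. g x - h x) = {}"

definition biseparating ::
  "('x \<Rightarrow> 'e::group_add) set \<Rightarrow> ('y \<Rightarrow> 'f::group_add) set \<Rightarrow> (('x \<Rightarrow> 'e) \<Rightarrow> ('y \<Rightarrow> 'f)) \<Rightarrow> bool"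
  where
  "biseparating A B T \<longleftrightarrow> bij_betw T A B \<and>
     (\<forall>f\<in>A. \<forall>g\<in>A. \<forall>h\<in>A. perp h f g \<longleftrightarrow> perp (T h) (T f) (T g))"

definition fun_subspace :: "('x \<Rightarrow> 'e::real_vector) set \<Rightarrow> bool" where
  "fun_subspace A \<longleftrightarrow> (\<lambda>x. 0) \<in> A \<and> (\<forall>f\<in>A. \<forall>g\<in>A. (\<lambda>x. f x + g x) \<in> A) \<and>
     (\<forall>c. \<forall>f\<in>A. (\<lambda>x. c *\<^sub>R f x) \<in> A)"

text \<open>As \<^const>\<open>diameter\<close> is real-valued and meaningless on unbounded sets, a bound on a
  diameter is accompanied by boundedness of the set.\<close>

definition standard_S1 :: "('x::metric_space \<Rightarrow> 'e::real_normed_vector) set \<Rightarrow> bool" where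
  "standard_S1 A \<longleftrightarrow> (\<forall>f\<in>A. \<forall>D\<in>hat_coz_sets A. \<forall>x. x \<notin> D \<longrightarrow>
     (\<exists>g\<in>A. \<exists>C\<in>coz_sets A. x \<in> C \<and> (\<forall>z\<in>C. g z = f z) \<and> (\<forall>z\<in>D. g z = 0)))"

definition standard_S2 :: "('x::metric_space \<Rightarrow> 'e::real_normed_vector) set \<Rightarrow> bool" where
  "standard_S2 A \<longleftrightarrow> (\<forall>x. \<forall>\<epsilon>>0. \<exists>C\<in>coz_sets A. x \<in> C \<and> bounded C \<and> diameter C < \<epsilon>)"

definition standard_S3 :: "('x::metric_space \<Rightarrow> 'e::real_normed_vector) set \<Rightarrow> bool" where
  "standard_S3 A \<longleftrightarrow> (\<forall>f\<in>A. \<forall>x::nat \<Rightarrow> 'x.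
     (\<exists>\<delta>>0. \<forall>n m. n \<noteq> m \<longrightarrow> \<delta> \<le> dist (x n) (x m)) \<longrightarrow>
     (\<exists>C. \<exists>g\<in>A. (\<forall>n. C n \<in> coz_sets A \<and> x n \<in> C n) \<and>
        (\<exists>\<^sub>\<infinity>n. \<forall>z\<in>C n. g z = f z) \<and> (\<exists>\<^sub>\<infinity>n. \<forall>z\<in>C n. g z = 0)))"

definition standard_S4 :: "('x::metric_space \<Rightarrow> 'e::real_normed_vector) set \<Rightarrow> bool" where
  "standard_S4 A \<longleftrightarrow> (\<forall>f\<in>A. \<forall>x x' :: nat \<Rightarrow> 'x.
     Cauchy x \<longrightarrow> Cauchy x' \<longrightarrow> (\<exists>\<delta>>0. \<forall>m n. \<delta> \<le> dist (x m) (x' n)) \<longrightarrow>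
     (\<exists>U\<in>coz_sets A. \<exists>V\<in>coz_sets A. \<exists>g\<in>A. (\<exists>\<^sub>\<infinity>n. x n \<in> U \<and> x' n \<in> V) \<and>
        (\<forall>z\<in>U. g z = f z) \<and> (\<forall>z\<in>V. g z = 0)))"

definition standard_space :: "('x::metric_space \<Rightarrow> 'e::real_normed_vector) set \<Rightarrow> bool" where
  "standard_space A \<longleftrightarrow> fun_subspace A \<and> (\<forall>f\<in>A. continuous_on UNIV f) \<and>
     standard_S1 A \<and> standard_S2 A \<and> standard_S3 A \<and> standard_S4 A"

definition property_P ::
  "('x::metric_space \<Rightarrow> 'xc::complete_space) \<Rightarrow> ('x \<Rightarrow> 'e::real_normed_vector) set \<Rightarrow> bool" where
  "property_P i A \<longleftrightarrow> (\<forall>x. x islimpt UNIV \<longrightarrow>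
     (\<forall>f\<in>A. (f \<longlongrightarrow> 0) (filtercomap i (at x)) \<longrightarrow>
       (\<exists>U V. \<exists>g\<in>A. open U \<and> open V \<and> x \<in> closure (i ` U) \<inter> closure (i ` V) \<and>
          (\<forall>z\<in>U. g z = f z) \<and> (\<forall>z\<in>V. g z = 0))))"

definition theta ::
  "('x \<Rightarrow> 'e::zero) set \<Rightarrow> ('y \<Rightarrow> 'f::zero) set \<Rightarrow> (('x \<Rightarrow> 'e) \<Rightarrow> ('y \<Rightarrow> 'f)) \<Rightarrow> 'x set \<Rightarrow> 'y set"
  where
  "theta A B T D = (THE D'. \<exists>h\<in>A. D = hat_coz A h \<and> D' = hat_coz B (T h))"

definition theta_inv ::
  "('x \<Rightarrow> 'e::zero) set \<Rightarrow> ('y \<Rightarrow> 'f::zero) set \<Rightarrow> (('x \<Rightarrow> 'e) \<Rightarrow> ('y \<Rightarrow> 'f)) \<Rightarrow> 'y set \<Rightarrow> 'x set"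
  where
  "theta_inv A B T = inv_into (hat_coz_sets A) (theta A B T)"

text \<open>The relation \<open>(U\<^sub>n) \<sim> x\<close>, where \<open>i\<close> embeds the space containing the \<open>U\<^sub>n\<close> into the
  space containing \<open>x\<close>.\<close>

definition shrinks_to ::
  "('x::metric_space \<Rightarrow> 'c::metric_space) \<Rightarrow> ('x \<Rightarrow> 'e::zero) set \<Rightarrow> (nat \<Rightarrow> 'x set) \<Rightarrow> 'c \<Rightarrow> bool"
  where
  "shrinks_to i A U x \<longleftrightarrow> (\<forall>n. U n \<in> coz_sets A \<and> U n \<noteq> {}) \<and>
     (\<forall>\<^sub>F n in sequentially. bounded (U n)) \<and> (\<lambda>n. diameter (U n)) \<longlonglongrightarrow> 0 \<and>
     (\<lambda>n. infdist x (i ` U n)) \<longlonglongrightarrow> 0"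

definition assoc_phi ::
  "('x::metric_space \<Rightarrow> 'e::zero) set \<Rightarrow> ('y::metric_space \<Rightarrow> 'f::zero) set
    \<Rightarrow> (('x \<Rightarrow> 'e) \<Rightarrow> ('y \<Rightarrow> 'f)) \<Rightarrow> 'x \<Rightarrow> 'y" where
  "assoc_phi A B T x = (THE y. \<forall>U ys. shrinks_to id A U x \<longrightarrow>
     (\<forall>n. ys n \<in> theta A B T (closure (U n))) \<longrightarrow> ys \<longlonglongrightarrow> y)"

definition assoc_psi ::
  "('x::metric_space \<Rightarrow> 'xc::complete_space) \<Rightarrow> ('x \<Rightarrow> 'e::zero) set
    \<Rightarrow> ('y::metric_space \<Rightarrow> 'f::zero) set \<Rightarrow> (('x \<Rightarrow> 'e) \<Rightarrow> ('y \<Rightarrow> 'f)) \<Rightarrow> 'y \<Rightarrow> 'xc" where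
  "assoc_psi i A B T y = (THE x. \<forall>V xs. shrinks_to id B V y \<longrightarrow>
     (\<forall>n. xs n \<in> theta_inv A B T (closure (V n))) \<longrightarrow> (\<lambda>n. i (xs n)) \<longlonglongrightarrow> x)"

end

theory Submission
  imports Defs
begin

text \<open>
  The argument has two layers. The first is that a biseparating map is local: for \<open>f\<close>, \<open>g\<close>, \<open>h\<close>
  in \<open>A\<close>, the functions \<open>f\<close> and \<open>g\<close> agree on the cozero set of \<open>h\<close> if and only if \<open>T f\<close> and
  \<open>T g\<close> agree on that of \<open>T h\<close> (lemma \<open>agree_iff\<close>). By definition of biseparating maps, agreement
  of \<open>f\<close> and \<open>g\<close> on \<open>coz h\<close> means agreement of \<open>T f\<close> and \<open>T g\<close> on the cozero set of
  \<open>T (g + h) - T g\<close>; what has to be shown is that the closure of this set does not depend on the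
  base point \<open>g\<close> (lemma \<open>increment_support_subset\<close>), so that \<open>g\<close> may be replaced by \<open>0\<close>.

  The second layer turns the correspondence of cozero sets into one of points. A cozero set in \<open>Y\<close>
  near \<open>y\<close> comes from a cozero set in \<open>X\<close> near a point \<open>\<psi> y\<close> of the completion of \<open>X\<close>. Otherwise
  there are two families of such sets in \<open>X\<close> that (S3) or (S4) can tell apart: some \<open>g\<close> equals the
  preimage of a nonzero constant near infinitely many sets of one family, and \<open>0\<close> near infinitely
  many of the other; by locality and continuity \<open>T g\<close> would have two different values at \<open>y\<close>.
  Conversely, a cozero set in \<open>X\<close> near a point \<open>x\<close> of the completion goes to a cozero set near a
  point \<open>y\<close> of \<open>Y\<close> itself. Otherwise there are disjoint closed sets \<open>P\<close>, \<open>Q\<close> in \<open>Y\<close> that are both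
  met by images of cozero sets arbitrarily near \<open>x\<close>; as \<open>B\<close> contains all continuous functions dominated by an element
  of \<open>B\<close>, some \<open>T h\<close> equals \<open>T c\<close> near \<open>P\<close> and \<open>0\<close> near \<open>Q\<close>, where \<open>c\<close> is a nonzero constant,
  and then \<open>h\<close> takes the values \<open>c\<close> and \<open>0\<close> at points that are arbitrarily close to each other,
  against uniform continuity. These two correspondences are inverse to each other.

  Now let \<open>x = \<psi> y\<close>. If two functions agree on an open set that accumulates at \<open>x\<close>, then their
  images agree at \<open>y\<close>, and conversely if \<open>x\<close> lies in \<open>X\<close>. So let the extensions of \<open>f\<close> and \<open>g\<close> agree
  at \<open>x\<close>. If \<open>x\<close> is isolated, it is itself an open set on which \<open>f = g\<close>. If not, property (P)
  for \<open>f - g\<close> provides an \<open>h\<close> that agrees with \<open>f\<close> on one open set accumulating at \<open>x\<close> and with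
  \<open>g\<close> on another one, and \<open>T f y = T h y = T g y\<close>. In the other direction the same works in \<open>Y\<close>,
  where the counterpart of (P) holds for all continuous functions (lemma \<open>glue_with_zero\<close>).
\<close>

section \<open>Metric preliminaries\<close>

text \<open>
  A cutoff of the form \<open>\<chi> d\<close>, where \<open>\<chi>\<close> is computed from the distances to \<open>P\<close> and \<open>Q\<close>. It need
  not extend continuously to \<open>P \<inter> Q\<close>, but there \<open>d\<close> vanishes and \<open>\<chi>\<close> is bounded. With disjoint \<open>P\<close>
  and \<open>Q\<close> this is Urysohn separation; with \<open>P \<inter> Q\<close> a single point it is property (P) for
  spaces of continuous functions.
\<close>

lemma glue_with_zero:
  fixes d :: "'a::metric_space \<Rightarrow> 'b::real_normed_vector"
  assumes "closed P" "closed Q" "P \<noteq> {}" "Q \<noteq> {}"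
    and cont: "continuous_on UNIV d" and zero: "\<And>z. z \<in> P \<inter> Q \<Longrightarrow> d z = 0"
  obtains g U V where "continuous_on UNIV g" "\<And>z. norm (g z) \<le> norm (d z)"
    "open U" "open V" "P - Q \<subseteq> U" "Q - P \<subseteq> V" "\<And>z. z \<in> U \<Longrightarrow> g z = d z" "\<And>z. z \<in> V \<Longrightarrow> g z = 0"
proof -
  define a b where "a z = infdist z P" and "b z = infdist z Q" for z
  have a0: "a z \<ge> 0" and b0: "b z \<ge> 0" for z
    by (simp_all add: a_def b_def infdist_nonneg)
  have aP: "a z = 0 \<longleftrightarrow> z \<in> P" and bQ: "b z = 0 \<longleftrightarrow> z \<in> Q" for z
    using assms by (simp_all add: a_def b_def in_closed_iff_infdist_zero)
  have ca: "isCont a z" and cb: "isCont b z" for z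
    unfolding a_def b_def by (intro continuous_intros)+
  \<comment> \<open>The ratio \<open>a / (a + b)\<close> is 0 on \<open>P - Q\<close> and 1 on \<open>Q - P\<close>; the factor 3 and the truncation make \<open>w\<close> constant near both.\<close>
  define w where "w z = max 0 (min 1 (2 - 3 * a z / (a z + b z)))" for z
  define g where "g z = w z *\<^sub>R d z" for z
  have w: "0 \<le> w z" "w z \<le> 1" for z
    by (simp_all add: w_def)
  have le: "norm (g z) \<le> norm (d z)" for z
    using w[of z] by (simp add: g_def mult_left_le_one_le)
  have "isCont g x" for x
  proof (cases "x \<in> P \<inter> Q")
    case True
    have "(d \<longlongrightarrow> d x) (at x)"
      using cont by (simp add: continuous_on_def)
    then have "(d \<longlongrightarrow> 0) (at x)"
      using zero[OF True] by simp
    then have "(g \<longlongrightarrow> 0) (at x)"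
      by (rule Lim_null_comparison[rotated, OF tendsto_norm_zero]) (simp add: le)
    moreover have "g x = 0"
      using zero[OF True] by (simp add: g_def)
    ultimately show ?thesis
      by (simp add: isCont_def)
  next
    case False
    then have "a x + b x \<noteq> 0"
      using a0[of x] b0[of x] aP[of x] bQ[of x] by auto
    moreover have "isCont d x"
      using cont by (simp add: continuous_on_eq_continuous_at)
    ultimately show ?thesis
      unfolding g_def w_def by (intro continuous_intros ca cb) auto
  qed
  then have "continuous_on UNIV g"
    by (simp add: continuous_at_imp_continuous_on)
  moreover have "open {z. 2 * a z < b z}" "open {z. 2 * b z < a z}"
    by (intro open_Collect_less continuous_on_mult_left continuous_at_imp_continuous_on ballI ca cb)+
  moreover have "P - Q \<subseteq> {z. 2 * a z < b z}" "Q - P \<subseteq> {z. 2 * b z < a z}"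
    using a0 b0 aP bQ by (force simp: less_le)+
  moreover have "g z = d z" if "z \<in> {z. 2 * a z < b z}" for z
  proof -
    have "3 * a z / (a z + b z) \<le> 1"
      using that a0[of z] by (simp add: field_simps)
    then show ?thesis
      by (simp add: g_def w_def)
  qed
  moreover have "g z = 0" if "z \<in> {z. 2 * b z < a z}" for z
  proof -
    have "3 * a z / (a z + b z) \<ge> 2"
      using that b0[of z] by (simp add: field_simps)
    then show ?thesis
      by (simp add: g_def w_def)
  qed
  ultimately show ?thesis
    using that le by blast
qed

text \<open>
  A point near which the sets keep returning is a limit of the whole family, since its small balls
  can be separated from the complements of larger ones. Such a point exists: a selection \<open>y\<close> either
  takes a value infinitely often, or its range has a limit point, or all subsets of its range are
  closed, and then the range splits into two infinite closed sets.
\<close>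

lemma decreasing_sets_converge:
  fixes S :: "nat \<Rightarrow> 'a::metric_space set"
  assumes dec: "\<And>m n. m \<le> n \<Longrightarrow> S n \<subseteq> S m" and ne: "\<And>n. S n \<noteq> {}"
    and sep: "\<And>P Q. closed P \<Longrightarrow> closed Q \<Longrightarrow> P \<inter> Q = {} \<Longrightarrow> \<exists>n. S n \<inter> P = {} \<or> S n \<inter> Q = {}"
  shows "\<exists>l. \<forall>\<epsilon>>0. \<exists>n. S n \<subseteq> ball l \<epsilon>"
proof -
  have "\<forall>n. \<exists>y. y \<in> S n"
    using ne by blast
  then obtain y where y: "\<And>n. y n \<in> S n"
    by metis
  have meets: "S n \<inter> P \<noteq> {}" if "infinite P" "P \<subseteq> range y" for P n
  proof -
    have "\<not> P \<subseteq> y ` {..<n}"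
      using that by (meson finite_imageI finite_lessThan finite_subset)
    then obtain z where z: "z \<in> P" "z \<notin> y ` {..<n}"
      by blast
    then obtain m where m: "z = y m"
      using \<open>P \<subseteq> range y\<close> by blast
    then have "y m \<in> P" "m \<ge> n"
      using z by (auto simp flip: not_less)
    then show ?thesis
      using y dec by blast
  qed
  have "\<exists>l. \<forall>\<epsilon>>0. \<forall>n. S n \<inter> ball l \<epsilon> \<noteq> {}"
  proof (cases "finite (range y)")
    case True
    then have "\<exists>v\<in>UNIV. infinite {n \<in> UNIV. y n = y v}"
      by (intro pigeonhole_infinite) simp_all
    then obtain v where v: "infinite {n. y n = y v}"
      by auto
    have "y v \<in> S n" for n
    proof -
      obtain m where "m \<ge> n" "y m = y v"
        using v unfolding infinite_nat_iff_unbounded_le by blast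
      then show ?thesis
        using y[of m] dec[of n m] by auto
    qed
    then show ?thesis
      by (intro exI[of _ "y v"]) force
  next
    case False
    show ?thesis
    proof (cases "\<exists>l. l islimpt range y")
      case True
      then obtain l where "\<And>\<epsilon>. \<epsilon> > 0 \<Longrightarrow> infinite (range y \<inter> ball l \<epsilon>)"
        by (auto simp: islimpt_eq_infinite_ball)
      then have "S n \<inter> ball l \<epsilon> \<noteq> {}" if "\<epsilon> > 0" for \<epsilon> n
        using meets[of "range y \<inter> ball l \<epsilon>" n] that by blast
      then show ?thesis
        by blast
    next
      case no_limit: False
      then have closed: "closed P" if "P \<subseteq> range y" for P
        using that by (meson closed_limpt islimpt_subset)
      obtain f :: "nat \<Rightarrow> 'a" where f: "inj f" "range f \<subseteq> range y"
        using infinite_countable_subset[OF False] by blast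
      define P Q where "P = range (\<lambda>n. f (2 * n))" and "Q = range (\<lambda>n. f (2 * n + 1))"
      have inf: "infinite P" "infinite Q"
        unfolding P_def Q_def
        by (intro range_inj_infinite injI, use injD[OF f(1)] in force)+
      have "2 * m \<noteq> 2 * n + 1" for m n :: nat
        by presburger
      then have "P \<inter> Q = {}"
        using injD[OF f(1)] by (fastforce simp: P_def Q_def)
      moreover have sub: "P \<subseteq> range y" "Q \<subseteq> range y"
        using f(2) by (auto simp: P_def Q_def)
      ultimately obtain n where "S n \<inter> P = {} \<or> S n \<inter> Q = {}"
        using sep[OF closed closed] by blast
      then show ?thesis
        using meets[OF inf(1) sub(1)] meets[OF inf(2) sub(2)] by blast
    qed
  qed
  then obtain l where l: "\<And>\<epsilon> n. \<epsilon> > 0 \<Longrightarrow> S n \<inter> ball l \<epsilon> \<noteq> {}"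
    by blast
  have "\<exists>n. S n \<subseteq> ball l \<epsilon>" if "\<epsilon> > 0" for \<epsilon>
  proof -
    have "- ball l \<epsilon> \<inter> cball l (\<epsilon> / 2) = {}"
      using that by auto
    then obtain n where "S n \<inter> - ball l \<epsilon> = {} \<or> S n \<inter> cball l (\<epsilon> / 2) = {}"
      using sep[of "- ball l \<epsilon>" "cball l (\<epsilon> / 2)"] by auto
    moreover have "S n \<inter> cball l (\<epsilon> / 2) \<noteq> {}"
      using l[of "\<epsilon> / 2" n] that by (force simp: disjoint_iff)
    ultimately show ?thesis
      by blast
  qed
  then show ?thesis
    by blast
qed

text \<open>
  If the range of \<open>x\<close> were not totally bounded, a greedy choice of points far from the earlier ones
  would give a separated sequence. The choice is made among late members of \<open>x\<close>, which is why the
  new sequence still runs through the sets \<open>S n\<close>.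
\<close>

lemma Cauchy_subsequence_if_no_separated:
  fixes S :: "nat \<Rightarrow> 'a::metric_space set"
  assumes dec: "\<And>m n. m \<le> n \<Longrightarrow> S n \<subseteq> S m"
    and sep: "\<And>s \<delta>. (\<And>n. s n \<in> S n) \<Longrightarrow> \<delta> > 0 \<Longrightarrow> \<exists>m n. m \<noteq> n \<and> dist (s m) (s n) < \<delta>"
    and x: "\<And>n. x n \<in> S n"
  obtains r :: "nat \<Rightarrow> nat" where "strict_mono r" "Cauchy (x \<circ> r)"
proof -
  have "Met_TC.mtotally_bounded (range x)"
    unfolding Met_TC.mtotally_bounded_def
  proof (rule ccontr)
    assume "\<not> (\<forall>\<epsilon>>0. \<exists>K. finite K \<and> K \<subseteq> range x \<and> range x \<subseteq> (\<Union>z\<in>K. Met_TC.mball z \<epsilon>))"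
    then obtain \<epsilon> where \<epsilon>: "\<epsilon> > 0"
      and no: "\<And>K. finite K \<Longrightarrow> K \<subseteq> range x \<Longrightarrow> \<not> range x \<subseteq> (\<Union>z\<in>K. ball z \<epsilon>)"
      by (auto simp: mball_eq_ball)
    define good where "good f n m \<longleftrightarrow> m \<ge> n \<and> (\<forall>j<n. \<epsilon> \<le> dist (x (f j)) (x m))"
      for f :: "nat \<Rightarrow> nat" and n m :: nat
    have "\<exists>f. \<forall>n. good f n (f n)"
    proof (rule dependent_wf_choice[of "{(m, n). m < n}"])
      show "wf {(m, n::nat). m < n}"
        by (rule wf)
      show "good f n m = good g n m"
        if "\<And>j. (j, n) \<in> {(m, n). m < n} \<Longrightarrow> f j = g j" for f g n m
        using that by (auto simp: good_def)
      show "\<exists>m. good f n m" for n f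
      proof -
        \<comment> \<open>Avoiding also the balls around \<open>x 0, \<dots>, x (n - 1)\<close> forces \<open>m \<ge> n\<close>.\<close>
        obtain m where m: "x m \<notin> (\<Union>z\<in>x ` f ` {..<n} \<union> x ` {..<n}. ball z \<epsilon>)"
          using no[of "x ` f ` {..<n} \<union> x ` {..<n}"] by blast
        then have "m \<ge> n"
          using \<epsilon> by (metis UnCI UN_iff centre_in_ball image_eqI lessThan_iff not_le)
        then show ?thesis
          using m by (auto simp: good_def not_less intro!: exI[of _ m])
      qed
    qed
    then obtain f where f: "\<And>n. good f n (f n)"
      by blast
    have far: "\<epsilon> \<le> dist (x (f m)) (x (f n))" if "m \<noteq> n" for m n
      using f[of n] f[of m] that by (cases m n rule: linorder_cases) (auto simp: good_def dist_commute)
    have "x (f n) \<in> S n" for n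
      using x[of "f n"] dec[of n "f n"] f[of n] by (auto simp: good_def)
    then show False
      using sep[of "\<lambda>n. x (f n)" \<epsilon>] \<epsilon> far by (meson not_le)
  qed
  then have "\<exists>r::nat \<Rightarrow> nat. strict_mono r \<and> Cauchy (x \<circ> r)"
    unfolding Met_TC.mtotally_bounded_sequentially by (simp add: MCauchy_iff_Cauchy)
  then show ?thesis
    using that by blast
qed

text \<open>
  The hypotheses \<open>sep\<close> and \<open>cau\<close> are the two ways in which (S3) and (S4) exclude that a family of sets spreads
  out: two selections that stay apart have Cauchy subsequences by the first one, and these contradict
  the second one.
\<close>

lemma decreasing_sets_small:
  fixes S :: "nat \<Rightarrow> 'a::metric_space set"
  assumes dec: "\<And>m n. m \<le> n \<Longrightarrow> S n \<subseteq> S m"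
    and sep: "\<And>s \<delta>. (\<And>n. s n \<in> S n) \<Longrightarrow> \<delta> > 0 \<Longrightarrow> \<exists>m n. m \<noteq> n \<and> dist (s m) (s n) < \<delta>"
    and cau: "\<And>s t \<delta>. (\<And>n. s n \<in> S n) \<Longrightarrow> (\<And>n. t n \<in> S n) \<Longrightarrow> Cauchy s \<Longrightarrow> Cauchy t \<Longrightarrow> \<delta> > 0
      \<Longrightarrow> \<exists>m n. dist (s m) (t n) < \<delta>"
    and "\<epsilon> > 0"
  shows "\<exists>n. \<forall>x\<in>S n. \<forall>z\<in>S n. dist x z < \<epsilon>"
proof (rule ccontr)
  assume "\<not> ?thesis"
  then obtain x z where xz: "\<And>n. x n \<in> S n" "\<And>n. z n \<in> S n" "\<And>n. \<epsilon> \<le> dist (x n) (z n)"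
    by (metis not_le)
  obtain r where r: "strict_mono r" "Cauchy (x \<circ> r)"
    using Cauchy_subsequence_if_no_separated[of S x, OF dec sep xz(1)] by blast
  have sub: "w (f n) \<in> S n" if "\<And>n. w n \<in> S n" "strict_mono f" for w f n
    using that dec[OF seq_suble[of f n]] by blast
  obtain q where q: "strict_mono q" "Cauchy (z \<circ> r \<circ> q)"
    using Cauchy_subsequence_if_no_separated[of S "z \<circ> r", OF dec sep] sub[OF xz(2) r(1)] by auto
  have p: "strict_mono (r \<circ> q)"
    using r q by (simp add: strict_mono_o)
  have cx: "Cauchy (x \<circ> r \<circ> q)"
    using r q by (simp add: Cauchy_subseq_Cauchy)
  obtain N where N: "\<And>m n. m \<ge> N \<Longrightarrow> n \<ge> N \<Longrightarrow> dist ((x \<circ> r \<circ> q) m) ((x \<circ> r \<circ> q) n) < \<epsilon> / 2"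
    using metric_CauchyD[OF cx, of "\<epsilon> / 2"] \<open>\<epsilon> > 0\<close> by auto
  define s t where "s n = x ((r \<circ> q) (n + N))" and "t n = z ((r \<circ> q) (n + N))" for n
  have shift: "strict_mono (\<lambda>n. (r \<circ> q) (n + N))"
    using p by (simp add: strict_mono_def)
  have "\<exists>m n. dist (s m) (t n) < \<epsilon> / 2"
  proof (rule cau)
    show "s n \<in> S n" "t n \<in> S n" for n
      unfolding s_def t_def using sub[OF _ shift] xz by blast+
    show "Cauchy s" "Cauchy t"
      using Cauchy_subseq_Cauchy[OF cx, of "\<lambda>n. n + N"] Cauchy_subseq_Cauchy[OF q(2), of "\<lambda>n. n + N"]
      by (simp_all add: strict_mono_def s_def[abs_def] t_def[abs_def] o_def)
  qed (use \<open>\<epsilon> > 0\<close> in simp)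
  then obtain m n where mn: "dist (s m) (t n) < \<epsilon> / 2"
    by blast
  have "dist (s n) (t n) \<le> dist (s m) (s n) + dist (s m) (t n)"
    by (metis dist_commute dist_triangle)
  also have "\<dots> < \<epsilon>"
    using mn N[of "m + N" "n + N"] by (simp add: s_def)
  finally show False
    using xz(3)[of "(r \<circ> q) (n + N)"] by (simp add: s_def t_def)
qed

section \<open>Function spaces and cozero sets\<close>

lemma fun_subspace_zero: "fun_subspace A \<Longrightarrow> (\<lambda>x. 0) \<in> A"
  and fun_subspace_add: "fun_subspace A \<Longrightarrow> f \<in> A \<Longrightarrow> g \<in> A \<Longrightarrow> (\<lambda>x. f x + g x) \<in> A"
  by (auto simp: fun_subspace_def)

lemma fun_subspace_diff:
  assumes "fun_subspace A" "f \<in> A" "g \<in> A"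
  shows "(\<lambda>x. f x - g x) \<in> A"
proof -
  have "(\<lambda>x. (-1) *\<^sub>R g x) \<in> A"
    using assms unfolding fun_subspace_def by blast
  then have "(\<lambda>x. f x + (-1) *\<^sub>R g x) \<in> A"
    using assms fun_subspace_add by blast
  then show ?thesis
    by simp
qed

lemma open_coz: "continuous_on UNIV f \<Longrightarrow> open (coz f)" for f :: "'a::topological_space \<Rightarrow> 'b::real_normed_vector"
  unfolding coz_def by (intro open_Collect_neq continuous_intros)

lemma agree_on_closure:
  fixes f g :: "'a::topological_space \<Rightarrow> 'b::real_normed_vector"
  assumes "continuous_on UNIV f" "continuous_on UNIV g" "\<And>z. z \<in> S \<Longrightarrow> f z = g z" "x \<in> closure S"
  shows "f x = g x"
proof -
  have "closed {z. f z = g z}"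
    using assms by (intro closed_Collect_eq)
  then have "closure S \<subseteq> {z. f z = g z}"
    using assms(3) by (intro closure_minimal) auto
  then show ?thesis
    using assms(4) by blast
qed

lemma open_disjoint_closure: "open W \<Longrightarrow> W \<inter> S = {} \<Longrightarrow> W \<inter> closure S = {}"
  by (simp add: open_Int_closure_eq_empty)

lemma perp_iff: "perp h f g \<longleftrightarrow> (\<forall>z\<in>coz (\<lambda>x. g x - h x). f z = h z)"
  by (auto simp: perp_def coz_def)

text \<open>
  The assumption \<open>bump\<close> says that the cozero sets form a base of the topology; this is
  what (S2) is used for.
\<close>

locale function_space =
  fixes A :: "('x::topological_space \<Rightarrow> 'e::real_normed_vector) set"
  assumes subspace: "fun_subspace A"
    and continuous: "f \<in> A \<Longrightarrow> continuous_on UNIV f"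
    and bump: "open W \<Longrightarrow> x \<in> W \<Longrightarrow> \<exists>h\<in>A. x \<in> coz h \<and> coz h \<subseteq> W"
begin

lemmas zero = fun_subspace_zero[OF subspace]
  and add = fun_subspace_add[OF subspace]
  and diff = fun_subspace_diff[OF subspace]

lemma coz_open: "f \<in> A \<Longrightarrow> open (coz f)"
  by (simp add: continuous open_coz)

lemma obtain_bump:
  assumes "open W" "x \<in> W"
  obtains h where "h \<in> A" "x \<in> coz h" "coz h \<subseteq> W"
  using bump[OF assms] by blast

lemma obtain_bump_outside:
  assumes "open W" "\<not> W \<subseteq> closure S"
  obtains h where "h \<in> A" "coz h \<noteq> {}" "coz h \<subseteq> W" "coz h \<inter> S = {}"
proof -
  obtain x where x: "x \<in> W - closure S"
    using assms by blast
  have "open (W - closure S)"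
    using assms by (simp add: open_Diff)
  from this x obtain h where "h \<in> A" "x \<in> coz h" "coz h \<subseteq> W - closure S"
    by (rule obtain_bump)
  then show ?thesis
    using that[of h] closure_subset[of S] by blast
qed

lemma hat_coz_eq_closure:
  assumes "f \<in> A"
  shows "hat_coz A f = closure (coz f)"
proof
  show "closure (coz f) \<subseteq> hat_coz A f"
  proof
    fix x assume x: "x \<in> closure (coz f)"
    have "x \<notin> C" if "C \<in> coz_sets A" "C \<inter> coz f = {}" for C
    proof -
      have "open C"
        using that coz_open by (auto simp: coz_sets_def)
      then show ?thesis
        using open_disjoint_closure[of C "coz f"] that x by blast
    qed
    then show "x \<in> hat_coz A f"
      unfolding hat_coz_def by blast
  qed
next
  show "hat_coz A f \<subseteq> closure (coz f)"
  proof
    fix x assume x: "x \<in> hat_coz A f"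
    show "x \<in> closure (coz f)"
    proof (rule ccontr)
      assume "x \<notin> closure (coz f)"
      then obtain h where h: "h \<in> A" "x \<in> coz h" "coz h \<subseteq> - closure (coz f)"
        using obtain_bump[of "- closure (coz f)" x] open_Compl[OF closed_closure] by blast
      then have "coz h \<in> coz_sets A" "coz h \<inter> coz f = {}"
        using closure_subset[of "coz f"] by (auto simp: coz_sets_def)
      then show False
        using x h unfolding hat_coz_def by blast
    qed
  qed
qed

end

section \<open>Biseparating maps are local\<close>

text \<open>
  The map \<open>T\<close> recentred at \<open>a\<close>, so that \<open>0\<close> goes to \<open>0\<close>.
\<close>

definition increment :: "(('x \<Rightarrow> 'e::real_normed_vector) \<Rightarrow> ('y \<Rightarrow> 'f::real_normed_vector))
    \<Rightarrow> ('x \<Rightarrow> 'e) \<Rightarrow> ('x \<Rightarrow> 'e) \<Rightarrow> 'y \<Rightarrow> 'f" where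
  "increment T a h = (\<lambda>y. T (\<lambda>x. a x + h x) y - T a y)"

text \<open>
  The assumption \<open>modify\<close> is condition (S1), with closures of cozero sets as the elements of
  \<open>\<D>(X)\<close> and an open set in place of the cozero set \<open>C\<close>.
\<close>

locale biseparating_map =
  A: function_space A + B: function_space B
  for A :: "('x::topological_space \<Rightarrow> 'e::real_normed_vector) set"
    and B :: "('y::topological_space \<Rightarrow> 'f::real_normed_vector) set" +
  fixes T :: "('x \<Rightarrow> 'e) \<Rightarrow> ('y \<Rightarrow> 'f)"
  assumes bisep: "biseparating A B T"
    and T_zero: "T (\<lambda>x. 0) = (\<lambda>y. 0)"
    and modify: "f \<in> A \<Longrightarrow> u \<in> A \<Longrightarrow> x \<notin> closure (coz u) \<Longrightarrow>
      \<exists>g\<in>A. \<exists>W. open W \<and> x \<in> W \<and> (\<forall>z\<in>W. g z = f z) \<and> (\<forall>z\<in>closure (coz u). g z = 0)"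
begin

lemma T_in: "f \<in> A \<Longrightarrow> T f \<in> B"
  using bisep by (auto simp: biseparating_def bij_betw_def)

lemma T_onto:
  assumes "k \<in> B"
  obtains h where "h \<in> A" "T h = k"
  using bisep assms by (auto simp: biseparating_def bij_betw_def)

lemma agree_relative:
  assumes "f \<in> A" "g \<in> A" "h \<in> A"
  shows "(\<forall>z\<in>coz (\<lambda>x. g x - h x). f z = h z) \<longleftrightarrow> (\<forall>z\<in>coz (\<lambda>y. T g y - T h y). T f z = T h z)"
  using bisep assms unfolding biseparating_def perp_iff by blast

lemma increment_in: "a \<in> A \<Longrightarrow> h \<in> A \<Longrightarrow> increment T a h \<in> B"
  unfolding increment_def by (intro B.diff T_in A.add)

lemma increment_onto:
  assumes "a \<in> A" "k \<in> B"
  obtains h where "h \<in> A" "increment T a h = k"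
proof -
  have "(\<lambda>y. k y + T a y) \<in> B"
    by (rule B.add[OF assms(2) T_in[OF assms(1)]])
  then obtain f where f: "f \<in> A" "T f = (\<lambda>y. k y + T a y)"
    using T_onto by blast
  then have "increment T a (\<lambda>x. f x - a x) = k"
    by (simp add: increment_def)
  then show ?thesis
    by (rule that[OF A.diff[OF f(1) assms(1)]])
qed

lemma agree_increment:
  assumes "a \<in> A" "f \<in> A" "h \<in> A"
  shows "(\<forall>z\<in>coz h. f z = a z) \<longleftrightarrow> (\<forall>z\<in>coz (increment T a h). T f z = T a z)"
  using agree_relative[OF assms(2) A.add[OF assms(1,3)] assms(1)]
  by (simp add: increment_def coz_def)

lemma increment_disjoint:
  assumes "a \<in> A" "f \<in> A" "h \<in> A"
  shows "coz f \<inter> coz h = {} \<longleftrightarrow> coz (increment T a f) \<inter> coz (increment T a h) = {}"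
proof -
  have "coz f \<inter> coz h = {} \<longleftrightarrow> (\<forall>z\<in>coz h. a z + f z = a z)"
    by (auto simp: coz_def)
  also have "\<dots> \<longleftrightarrow> (\<forall>z\<in>coz (increment T a h). T (\<lambda>x. a x + f x) z = T a z)"
    by (rule agree_increment[OF assms(1) A.add[OF assms(1,2)] assms(3)])
  also have "\<dots> \<longleftrightarrow> coz (increment T a f) \<inter> coz (increment T a h) = {}"
    by (auto simp: coz_def increment_def)
  finally show ?thesis .
qed

lemma increment_eq_zero:
  assumes "a \<in> A" "h \<in> A" "coz (increment T a h) = {}"
  shows "coz h = {}"
  using increment_disjoint[of a h h] assms by auto

text \<open>
  Inclusion of the closed supports can be read off from disjointness: it means that no nonempty
  cozero set inside the smaller one misses the larger one. Disjointness is preserved, hence so is inclusion.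
\<close>

lemma increment_support_mono:
  assumes "a \<in> A" "f \<in> A" "h \<in> A" and sub: "coz f \<subseteq> closure (coz h)"
  shows "coz (increment T a f) \<subseteq> closure (coz (increment T a h))"
proof (rule ccontr)
  assume "\<not> ?thesis"
  then obtain k where k: "k \<in> B" "coz k \<noteq> {}" "coz k \<subseteq> coz (increment T a f)"
      "coz k \<inter> coz (increment T a h) = {}"
    by (rule B.obtain_bump_outside[OF B.coz_open[OF increment_in[OF assms(1,2)]]])
  obtain m where m: "m \<in> A" "increment T a m = k"
    by (rule increment_onto[OF assms(1) k(1)])
  have "coz m \<inter> coz h = {}"
    using increment_disjoint[of a m h] m k assms by blast
  then have "coz m \<inter> coz f = {}"
    using open_disjoint_closure[OF A.coz_open[OF m(1)]] sub by blast
  then show False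
    using increment_disjoint[of a m f] m k assms by blast
qed

lemma increment_support_mono_converse:
  assumes "a \<in> A" "f \<in> A" "h \<in> A"
    and sub: "coz (increment T a f) \<subseteq> closure (coz (increment T a h))"
  shows "coz f \<subseteq> closure (coz h)"
proof (rule ccontr)
  assume "\<not> ?thesis"
  then obtain m where m: "m \<in> A" "coz m \<noteq> {}" "coz m \<subseteq> coz f" "coz m \<inter> coz h = {}"
    by (rule A.obtain_bump_outside[OF A.coz_open[OF assms(2)]])
  have "coz (increment T a m) \<inter> coz (increment T a h) = {}"
    using increment_disjoint[of a m h] m assms by blast
  then have "coz (increment T a m) \<inter> coz (increment T a f) = {}"
    using open_disjoint_closure[OF B.coz_open[OF increment_in]] assms m sub by blast
  then show False
    using increment_disjoint[of a m f] m assms by blast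
qed

text \<open>
  Independence of the support of an increment from the base point. If it fails, some \<open>k \<noteq> 0\<close> in \<open>B\<close>
  is the increment of \<open>h1\<close> at \<open>b\<close> and of \<open>h2\<close> at \<open>a\<close>, where \<open>h1\<close> and \<open>h2\<close> are disjoint. Near a
  point \<open>x\<close> of \<open>coz h1\<close>, any \<open>c\<close> in \<open>A\<close> coincides with some \<open>a + g\<close>, where \<open>g\<close> vanishes on the
  support of \<open>h2\<close>. Therefore \<open>T (a + g)\<close> equals \<open>T a\<close> on the support of \<open>k\<close>, and it equals \<open>T c\<close>
  on the cozero sets of all increments at \<open>c\<close> by functions living close to \<open>x\<close>. Taking \<open>c = b\<close> and
  \<open>c = b + p\<close> with \<open>p\<close> living close to \<open>x\<close> shows that \<open>T b\<close> and \<open>T (b + p)\<close> both equal \<open>T a\<close> at a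
  place where they differ.
\<close>

lemma increment_support_subset:
  assumes "a \<in> A" "b \<in> A" "h \<in> A"
  shows "coz (increment T b h) \<subseteq> closure (coz (increment T a h))"
proof (rule ccontr)
  assume "\<not> ?thesis"
  then obtain k where k: "k \<in> B" "coz k \<noteq> {}" "coz k \<subseteq> coz (increment T b h)"
      "coz k \<inter> coz (increment T a h) = {}"
    by (rule B.obtain_bump_outside[OF B.coz_open[OF increment_in[OF assms(2,3)]]])
  obtain h1 where h1: "h1 \<in> A" "increment T b h1 = k"
    using increment_onto[OF assms(2) k(1)] .
  obtain h2 where h2: "h2 \<in> A" "increment T a h2 = k"
    using increment_onto[OF assms(1) k(1)] .
  have "coz h2 \<inter> coz h = {}"
    using increment_disjoint[of a h2 h] h2 k assms by blast
  moreover have "coz h1 \<subseteq> closure (coz h)"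
    using increment_support_mono_converse[of b h1 h] h1 k assms closure_subset by blast
  ultimately have "coz h2 \<inter> coz h1 = {}"
    using A.coz_open[OF h2(1)] open_disjoint_closure[of "coz h2" "coz h"] by blast
  then have disj: "coz h1 \<inter> closure (coz h2) = {}"
    using A.coz_open[OF h1(1)] open_disjoint_closure[of "coz h1" "coz h2"] by blast
  obtain x where x: "x \<in> coz h1"
    using increment_disjoint[of b h1 h1] h1 k assms by blast
  have Ta: "T (\<lambda>z. a z + g z) z = T a z"
    if g: "g \<in> A" "\<And>z. z \<in> closure (coz h2) \<Longrightarrow> g z = 0" and z: "z \<in> closure (coz k)" for g z
  proof (rule agree_on_closure[OF _ _ _ z])
    have ag: "(\<lambda>z. a z + g z) \<in> A"
      by (rule A.add[OF assms(1) g(1)])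
    then show "continuous_on UNIV (T (\<lambda>z. a z + g z))" "continuous_on UNIV (T a)"
      by (simp_all add: B.continuous T_in assms)
    have "\<forall>z\<in>coz h2. a z + g z = a z"
      using g(2) closure_subset[of "coz h2"] by auto
    then have "\<forall>z\<in>coz k. T (\<lambda>z. a z + g z) z = T a z"
      using agree_increment[OF assms(1) ag h2(1)] h2(2) by simp
    then show "T (\<lambda>z. a z + g z) z = T a z" if "z \<in> coz k" for z
      using that by blast
  qed
  have Tb: "\<exists>p\<in>A. x \<in> coz p \<and> coz p \<subseteq> W \<and> (\<forall>z\<in>coz (increment T c p) \<inter> closure (coz k). T c z = T a z)"
    if c: "c \<in> A" and W: "open W" "x \<in> W" for c W
  proof -
    have "x \<notin> closure (coz h2)"
      using x disj by blast
    from modify[OF A.diff[OF c assms(1)] h2(1) this]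
    obtain g V where g: "g \<in> A" "open V" "x \<in> V" "\<forall>z\<in>V. g z = c z - a z"
        "\<forall>z\<in>closure (coz h2). g z = 0"
      by (elim bexE exE conjE)
    obtain p where p: "p \<in> A" "x \<in> coz p" "coz p \<subseteq> V \<inter> W"
      using A.obtain_bump[OF open_Int[OF g(2) W(1)] IntI[OF g(3) W(2)]] .
    have "\<forall>z\<in>coz p. a z + g z = c z"
      using p g by auto
    then have "\<forall>z\<in>coz (increment T c p). T (\<lambda>z. a z + g z) z = T c z"
      using agree_increment[OF c A.add[OF assms(1) g(1)] p(1)] by blast
    then have "\<forall>z\<in>coz (increment T c p) \<inter> closure (coz k). T c z = T a z"
      using Ta[OF g(1) bspec[OF g(5)]] by (metis IntE)
    then show ?thesis
      using p by blast
  qed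
  obtain p where p: "p \<in> A" "x \<in> coz p" "coz p \<subseteq> coz h1"
    and pT: "\<And>z. z \<in> coz (increment T b p) \<inter> closure (coz k) \<Longrightarrow> T b z = T a z"
    using Tb[of b "coz h1"] assms x A.coz_open[OF h1(1)] by blast
  define b' where "b' = (\<lambda>z. b z + p z)"
  have b': "b' \<in> A"
    unfolding b'_def by (rule A.add[OF assms(2) p(1)])
  obtain q where q: "q \<in> A" "x \<in> coz q" "coz q \<subseteq> coz p"
    and qT: "\<And>z. z \<in> coz (increment T b' q) \<inter> closure (coz k) \<Longrightarrow> T b' z = T a z"
    using Tb[of b' "coz p"] b' p(2) A.coz_open[OF p(1)] by blast
  define pq where "pq = (\<lambda>z. p z + q z)"
  have pq: "pq \<in> A" "coz pq \<subseteq> coz p"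
    unfolding pq_def using A.add[OF p(1) q(1)] q(3) by (auto simp: coz_def)
  have inc: "increment T b' q z = increment T b pq z - increment T b p z" for z
    by (simp add: increment_def b'_def pq_def add.assoc)
  have sub_p: "coz (increment T b p) \<subseteq> closure (coz k)"
    using increment_support_mono[of b p h1] p h1 assms closure_subset by blast
  have sub_pq: "coz (increment T b pq) \<subseteq> closure (coz (increment T b p))"
    using increment_support_mono[of b pq p] pq p(1) assms closure_subset by blast
  obtain z where z: "z \<in> coz (increment T b' q)"
    using increment_eq_zero[OF b' q(1)] q(2) by blast
  \<comment> \<open>Where the increment by \<open>p\<close> at \<open>b\<close> is nonzero, \<open>T b = T a\<close> and \<open>T b' = T a\<close> are incompatible.\<close>
  have vanish: "increment T b p z = 0" if z: "z \<in> coz (increment T b' q)" for z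
  proof (rule ccontr)
    assume "increment T b p z \<noteq> 0"
    then have zp: "z \<in> coz (increment T b p)"
      by (simp add: coz_def)
    then have "T b z = T a z" "T b' z = T a z"
      using pT qT z sub_p by blast+
    then show False
      using zp by (simp add: coz_def increment_def b'_def)
  qed
  then have "z \<in> coz (increment T b pq)"
    using z inc[of z] vanish[OF z] by (simp add: coz_def)
  then have "z \<in> closure (coz (increment T b p))"
    using sub_pq by blast
  moreover have "coz (increment T b' q) \<inter> coz (increment T b p) = {}"
    using vanish by (auto simp: coz_def)
  ultimately show False
    using z B.coz_open[OF increment_in[OF b' q(1)]]
      open_disjoint_closure[of "coz (increment T b' q)" "coz (increment T b p)"] by blast
qed

lemma increment_zero: "increment T (\<lambda>x. 0) h = T h"
  by (simp add: increment_def T_zero)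

text \<open>
  Both sides express \<open>g\<close>-relative disjointness of \<open>f\<close> and \<open>g + h\<close>, up to the replacement of the
  increment \<open>T (g + h) - T g\<close> by \<open>T h\<close>, which has the same closed support.
\<close>

lemma agree_iff:
  assumes "f \<in> A" "g \<in> A" "h \<in> A"
  shows "(\<forall>z\<in>coz h. f z = g z) \<longleftrightarrow> (\<forall>z\<in>coz (T h). T f z = T g z)"
proof -
  have *: "\<forall>z\<in>D. T f z = T g z" if "\<forall>z\<in>C. T f z = T g z" "D \<subseteq> closure C" for C D :: "'y set"
    using that agree_on_closure[OF B.continuous[OF T_in[OF assms(1)]] B.continuous[OF T_in[OF assms(2)]], of C]
    by blast
  have "coz (increment T g h) \<subseteq> closure (coz (T h))" "coz (T h) \<subseteq> closure (coz (increment T g h))"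
    using increment_support_subset[OF A.zero assms(2,3)] increment_support_subset[OF assms(2) A.zero assms(3)]
    by (simp_all add: increment_zero)
  note sub = this
  have "(\<forall>z\<in>coz h. f z = g z) \<longleftrightarrow> (\<forall>z\<in>coz (increment T g h). T f z = T g z)"
    by (rule agree_increment[OF assms(2,1,3)])
  also have "\<dots> \<longleftrightarrow> (\<forall>z\<in>coz (T h). T f z = T g z)"
    using *[OF _ sub(1)] *[OF _ sub(2)] by (rule iffI[rotated])
  finally show ?thesis .
qed

lemmas disjoint_iff = increment_disjoint[OF A.zero, unfolded increment_zero]
  and support_mono = increment_support_mono[OF A.zero, unfolded increment_zero]
  and support_mono_converse = increment_support_mono_converse[OF A.zero, unfolded increment_zero]

lemma coz_T_empty_iff: "h \<in> A \<Longrightarrow> coz (T h) = {} \<longleftrightarrow> coz h = {}"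
  using disjoint_iff[of h h] by auto

text \<open>
  Near a point of \<open>coz u \<inter> W\<close> there is a smaller cozero set, and its image meets \<open>coz (T u)\<close>.
  So an agreement of functions anywhere on the cozero set is visible in its image; the next lemma is
  the same for \<open>T\<close> inverse.
\<close>

lemma agree_in_image:
  assumes "f \<in> A" "g \<in> A" "u \<in> A" "open W" "coz u \<inter> W \<noteq> {}" "\<And>z. z \<in> W \<Longrightarrow> f z = g z"
  shows "\<exists>y\<in>coz (T u). T f y = T g y"
proof -
  obtain x where "x \<in> coz u \<inter> W"
    using assms by blast
  then obtain w where w: "w \<in> A" "x \<in> coz w" "coz w \<subseteq> coz u \<inter> W"
    using A.obtain_bump[OF open_Int[OF A.coz_open[OF assms(3)] assms(4)]] by metis
  then have "coz (T w) \<inter> coz (T u) \<noteq> {}"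
    using disjoint_iff[of w u] assms by blast
  moreover have "\<forall>z\<in>coz (T w). T f z = T g z"
    using agree_iff[of f g w] w assms by blast
  ultimately show ?thesis
    by blast
qed

lemma agree_in_preimage:
  assumes "f \<in> A" "g \<in> A" "u \<in> A" "open W" "coz (T u) \<inter> W \<noteq> {}" "\<And>z. z \<in> W \<Longrightarrow> T f z = T g z"
  shows "\<exists>x\<in>coz u. f x = g x"
proof -
  obtain y where "y \<in> coz (T u) \<inter> W"
    using assms by blast
  then obtain k where k: "k \<in> B" "y \<in> coz k" "coz k \<subseteq> coz (T u) \<inter> W"
    using B.obtain_bump[OF open_Int[OF B.coz_open[OF T_in[OF assms(3)]] assms(4)]] by metis
  obtain w where w: "w \<in> A" "T w = k"
    using T_onto k by blast
  then have "coz w \<inter> coz u \<noteq> {}"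
    using disjoint_iff[of w u] k assms by blast
  moreover have "\<forall>z\<in>coz w. f z = g z"
    using agree_iff[of f g w] w k assms by blast
  ultimately show ?thesis
    by blast
qed

lemma closure_coz_eq_iff:
  assumes "f \<in> A" "h \<in> A"
  shows "closure (coz f) = closure (coz h) \<longleftrightarrow> closure (coz (T f)) = closure (coz (T h))"
proof -
  have *: "closure C = closure D \<longleftrightarrow> C \<subseteq> closure D \<and> D \<subseteq> closure C" for C D :: "'z::topological_space set"
    by (metis closure_minimal closed_closure closure_subset subset_antisym subset_trans)
  show ?thesis
    unfolding * using assms support_mono support_mono_converse by blast
qed

lemma theta_closure_coz:
  assumes "h \<in> A"
  shows "theta A B T (closure (coz h)) = closure (coz (T h))"
  unfolding theta_def
proof (rule the_equality)
  show "\<exists>f\<in>A. closure (coz h) = hat_coz A f \<and> closure (coz (T h)) = hat_coz B (T f)"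
    using assms A.hat_coz_eq_closure B.hat_coz_eq_closure T_in by blast
  show "D = closure (coz (T h))" if "\<exists>f\<in>A. closure (coz h) = hat_coz A f \<and> D = hat_coz B (T f)" for D
    using that assms closure_coz_eq_iff A.hat_coz_eq_closure B.hat_coz_eq_closure T_in by metis
qed

lemma theta_inv_closure_coz:
  assumes "h \<in> A"
  shows "theta_inv A B T (closure (coz (T h))) = closure (coz h)"
proof -
  have "inj_on (theta A B T) (hat_coz_sets A)"
  proof (rule inj_onI)
    fix C D assume "C \<in> hat_coz_sets A" "D \<in> hat_coz_sets A" and eq: "theta A B T C = theta A B T D"
    then obtain f g where "f \<in> A" "g \<in> A" "C = closure (coz f)" "D = closure (coz g)"
      by (auto simp: hat_coz_sets_def A.hat_coz_eq_closure)
    then show "C = D"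
      using eq by (simp add: theta_closure_coz closure_coz_eq_iff)
  qed
  moreover have "closure (coz h) \<in> hat_coz_sets A"
    unfolding hat_coz_sets_def using assms A.hat_coz_eq_closure by blast
  ultimately show ?thesis
    unfolding theta_inv_def using inv_into_f_f theta_closure_coz[OF assms] by metis
qed

end

section \<open>The point maps of a biseparating map\<close>

lemma frequently_near_closed:
  fixes y :: "'a::metric_space"
  assumes "closed S" "\<exists>\<^sub>\<infinity>n. \<exists>z\<in>ball y (1 / real (Suc n)). z \<in> S"
  shows "y \<in> S"
proof -
  have "\<exists>z\<in>S. dist z y < e" if e: "e > 0" for e
  proof -
    obtain N where N: "1 / real (Suc N) < e"
      by (rule nat_approx_posE[OF e])
    obtain n z where n: "n > N" "z \<in> ball y (1 / real (Suc n))" "z \<in> S"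
      using assms(2) unfolding INFM_nat by blast
    have "1 / real (Suc n) \<le> 1 / real (Suc N)"
      using n by (intro divide_left_mono) auto
    then have "dist z y < e"
      using n N by (simp add: dist_commute)
    then show ?thesis
      using n by blast
  qed
  then have "y \<in> closure S"
    by (auto simp: closure_approachable)
  then show ?thesis
    using assms(1) by simp
qed

lemma closed_insert_limit:
  fixes f :: "nat \<Rightarrow> 'a::t2_space"
  assumes "f \<longlonglongrightarrow> l"
  shows "closed (insert l (range f))"
  using sequence_unique_limpt[OF assms] by (auto simp: closed_limpt islimpt_insert)

lemma limit_point_injective_sequence:
  fixes y :: "'a::metric_space"
  assumes "y islimpt UNIV"
  obtains s :: "nat \<Rightarrow> 'a" where "\<And>n. s n \<noteq> y" "inj s" "s \<longlonglongrightarrow> y"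
proof -
  have near: "\<exists>z. z \<noteq> y \<and> dist z y < e" if "e > 0" for e
    using assms that by (auto simp: islimpt_approachable)
  have "\<exists>s. \<forall>n. (s n \<noteq> y \<and> dist (s n) y < 1 / real (Suc n)) \<and> dist (s (Suc n)) y < dist (s n) y"
  proof (rule dependent_nat_choice)
    show "\<exists>z. z \<noteq> y \<and> dist z y < 1 / real (Suc 0)"
      by (rule near) simp
    show "\<exists>w. (w \<noteq> y \<and> dist w y < 1 / real (Suc (Suc n))) \<and> dist w y < dist z y"
      if "z \<noteq> y \<and> dist z y < 1 / real (Suc n)" for z n
      using near[of "min (1 / real (Suc (Suc n))) (dist z y)"] that by (simp del: of_nat_Suc)
  qed
  then obtain s where s: "\<And>n. s n \<noteq> y" "\<And>n. dist (s n) y < 1 / real (Suc n)"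
      "\<And>n. dist (s (Suc n)) y < dist (s n) y"
    by blast
  have "strict_mono (\<lambda>n. - dist (s n) y)"
    using s(3) by (simp add: strict_mono_Suc_iff)
  then have "inj (\<lambda>n. - dist (s n) y)"
    by (rule strict_mono_imp_inj_on)
  then have "inj s"
    by (auto simp: inj_on_def)
  moreover have "s \<longlonglongrightarrow> y"
  proof (rule metric_LIMSEQ_I)
    fix e :: real assume "e > 0"
    then obtain N where N: "1 / real (Suc N) < e"
      by (rule nat_approx_posE)
    have "dist (s n) y < e" if "n \<ge> N" for n
    proof -
      have "1 / real (Suc n) \<le> 1 / real (Suc N)"
        using that by (intro divide_left_mono) auto
      then show ?thesis
        using s(2)[of n] N by linarith
    qed
    then show "\<exists>N. \<forall>n\<ge>N. dist (s n) y < e"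
      by blast
  qed
  ultimately show ?thesis
    using that s(1) by blast
qed

lemma completion_dist:
  assumes "is_completion i"
  shows "dist (i a) (i b) = dist a b"
  using assms by (simp add: is_completion_def)

lemma shrinks_to_eventually:
  fixes x :: "'a::metric_space"
  assumes "shrinks_to id A V x" "e > 0"
  shows "\<forall>\<^sub>F n in sequentially. V n \<subseteq> ball x e"
proof -
  have "\<forall>\<^sub>F n in sequentially. bounded (V n)"
    and "(\<lambda>n. diameter (V n)) \<longlonglongrightarrow> 0" "(\<lambda>n. infdist x (V n)) \<longlonglongrightarrow> 0"
    and ne: "\<And>n. V n \<noteq> {}"
    using assms by (auto simp: shrinks_to_def)
  then have "\<forall>\<^sub>F n in sequentially. bounded (V n)"
    "\<forall>\<^sub>F n in sequentially. diameter (V n) < e / 2"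
    "\<forall>\<^sub>F n in sequentially. infdist x (V n) < e / 2"
    using assms(2) by (auto simp del: less_divide_eq_numeral1 intro: order_tendstoD(2))
  then show ?thesis
  proof eventually_elim
    case (elim n)
    have "(INF a\<in>V n. dist x a) < e / 2"
      using elim(3) ne by (simp add: infdist_def)
    then obtain a where a: "a \<in> V n" "dist x a < e / 2"
      using ne[of n] by (subst (asm) cINF_less_iff) (auto intro: bdd_belowI[of _ 0])
    show ?case
    proof
      fix b assume b: "b \<in> V n"
      have "dist a b \<le> diameter (V n)"
        using diameter_bounded_bound elim(1) a(1) b by blast
      then show "b \<in> ball x e"
        using dist_triangle[of x b a] a elim(2) by simp
    qed
  qed
qed

lemma shrinks_to_exists:
  fixes x :: "'a::metric_space"
  assumes "function_space A"
  shows "\<exists>V. shrinks_to id A V x"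
proof -
  interpret function_space A
    by fact
  have "\<forall>n. \<exists>h. h \<in> A \<and> x \<in> coz h \<and> coz h \<subseteq> ball x (1 / real (Suc n))"
  proof
    fix n
    show "\<exists>h. h \<in> A \<and> x \<in> coz h \<and> coz h \<subseteq> ball x (1 / real (Suc n))"
      using bump[of "ball x (1 / real (Suc n))" x, OF open_ball] by (simp add: Bex_def del: of_nat_Suc)
  qed
  then obtain h where h: "\<And>n. h n \<in> A" "\<And>n. x \<in> coz (h n)" "\<And>n. coz (h n) \<subseteq> ball x (1 / real (Suc n))"
    by metis
  have b: "bounded (coz (h n))" for n
    using h(3) bounded_ball bounded_subset by blast
  have d: "diameter (coz (h n)) \<le> 2 / real (Suc n)" for n
  proof -
    have "diameter (coz (h n)) \<le> diameter (ball x (1 / real (Suc n)))"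
      using h(3) by (intro diameter_subset) auto
    also have "\<dots> \<le> 2 / real (Suc n)"
      unfolding diameter_def
    proof (simp del: of_nat_Suc, intro impI cSUP_least)
      fix p assume "p \<in> ball x (1 / real (Suc n)) \<times> ball x (1 / real (Suc n))"
      then show "(case p of (u, v) \<Rightarrow> dist u v) \<le> 2 / real (Suc n)"
        using dist_triangle3[of "fst p" "snd p" x] by (auto simp del: of_nat_Suc less_divide_eq pos_less_divide_eq split: prod.split)
    qed auto
    finally show ?thesis .
  qed
  have "(\<lambda>n. diameter (coz (h n))) \<longlonglongrightarrow> 0"
  proof (rule tendsto_sandwich[OF _ _ tendsto_const])
    show "\<forall>\<^sub>F n in sequentially. diameter (coz (h n)) \<le> 2 / real (Suc n)"
      using d by simp
    show "\<forall>\<^sub>F n in sequentially. 0 \<le> diameter (coz (h n))"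
      using b by (simp add: diameter_ge_0)
    show "(\<lambda>n. 2 / real (Suc n)) \<longlonglongrightarrow> 0"
      using tendsto_mult_right_zero[OF LIMSEQ_inverse_real_of_nat, of 2] by (simp add: field_simps)
  qed
  moreover have "infdist x (coz (h n)) = 0" for n
    using h(2) by simp
  ultimately have "shrinks_to id A (\<lambda>n. coz (h n)) x"
    using h b by (force simp: shrinks_to_def coz_sets_def simp del: of_nat_Suc)
  then show ?thesis
    by blast
qed

text \<open>
  The assumption \<open>dominated\<close> covers both \<open>C(Y,F)\<close> and \<open>C\<^sub>*(Y,F)\<close>: it is all that is needed to
  perform cutoffs in \<open>B\<close>.
\<close>

locale biseparating_uniform_map = biseparating_map A B T
  for A :: "('x::metric_space \<Rightarrow> 'e::real_normed_vector) set"
    and B :: "('y::metric_space \<Rightarrow> 'f::real_normed_vector) set"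
    and T +
  fixes iX :: "'x \<Rightarrow> 'xc::complete_space"
  assumes completion: "is_completion iX"
    and S3: "standard_S3 A" and S4: "standard_S4 A"
    and uniform: "f \<in> A \<Longrightarrow> uniformly_continuous_on UNIV f"
    and const_A: "\<exists>c. c \<noteq> 0 \<and> (\<lambda>x. c) \<in> A"
    and const_B: "\<exists>v. v \<noteq> 0 \<and> (\<lambda>y. v) \<in> B"
    and dominated: "d \<in> B \<Longrightarrow> continuous_on UNIV g \<Longrightarrow> (\<And>z. norm (g z) \<le> norm (d z)) \<Longrightarrow> g \<in> B"
begin

lemma dist_iX: "dist (iX a) (iX b) = dist a b"
  by (rule completion_dist[OF completion])

lemma dense_iX: "x \<in> closure (range iX)"
  using completion by (simp add: is_completion_def)

lemma continuous_iX: "continuous_on S iX"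
  unfolding continuous_on_iff by (auto simp: dist_iX)

lemma open_vimage_iX: "open W \<Longrightarrow> open (iX -` W)"
  by (rule open_vimage[OF _ continuous_iX])

lemma obtain_near:
  assumes "x \<in> closure (iX ` W)" "open W" "\<delta> > 0"
  obtains u where "u \<in> A" "coz u \<noteq> {}" "coz u \<subseteq> W" "iX ` coz u \<subseteq> ball x \<delta>"
proof -
  obtain a where a: "a \<in> W" "dist (iX a) x < \<delta>"
    using assms by (auto simp: closure_approachable)
  have "open (W \<inter> iX -` ball x \<delta>)"
    using assms open_vimage_iX open_ball by blast
  moreover have "a \<in> W \<inter> iX -` ball x \<delta>"
    using a by (simp add: dist_commute)
  ultimately obtain u where "u \<in> A" "a \<in> coz u" "coz u \<subseteq> W \<inter> iX -` ball x \<delta>"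
    by (rule A.obtain_bump)
  then show ?thesis
    using that[of u] by blast
qed

lemma obtain_T_near:
  assumes "y \<in> closure W" "open W" "\<delta> > 0"
  obtains u where "u \<in> A" "coz u \<noteq> {}" "coz (T u) \<noteq> {}" "coz (T u) \<subseteq> W" "coz (T u) \<subseteq> ball y \<delta>"
proof -
  obtain a where a: "a \<in> W" "dist a y < \<delta>"
    using assms by (auto simp: closure_approachable)
  have "open (W \<inter> ball y \<delta>)"
    using assms by blast
  moreover have "a \<in> W \<inter> ball y \<delta>"
    using a by (simp add: dist_commute)
  ultimately obtain k where k: "k \<in> B" "a \<in> coz k" "coz k \<subseteq> W \<inter> ball y \<delta>"
    by (rule B.obtain_bump)
  obtain u where "u \<in> A" "T u = k"
    by (rule T_onto[OF k(1)])
  then show ?thesis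
    using that[of u] k coz_T_empty_iff[of u] by blast
qed

text \<open>
  The relations \<open>\<psi> y = x\<close> and \<open>\<phi> x = y\<close>, in a form that speaks about all small cozero sets at once
  instead of sequences. The second one is considered at all points of the completion, not only at
  those of \<open>X\<close>; this is what makes the relations converse to each other.
\<close>

definition psi_at :: "'y \<Rightarrow> 'xc \<Rightarrow> bool" where
  "psi_at y x \<longleftrightarrow> (\<forall>\<epsilon>>0. \<exists>\<delta>>0. \<forall>u\<in>A. coz (T u) \<subseteq> ball y \<delta> \<longrightarrow> iX ` coz u \<subseteq> ball x \<epsilon>)"

definition phi_at :: "'xc \<Rightarrow> 'y \<Rightarrow> bool" where
  "phi_at x y \<longleftrightarrow> (\<forall>\<epsilon>>0. \<exists>\<delta>>0. \<forall>u\<in>A. iX ` coz u \<subseteq> ball x \<delta> \<longrightarrow> coz (T u) \<subseteq> ball y \<epsilon>)"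

lemma psi_at_obtain:
  assumes "psi_at y x" "\<epsilon> > 0"
  obtains \<delta> where "\<delta> > 0" "\<And>u. u \<in> A \<Longrightarrow> coz (T u) \<subseteq> ball y \<delta> \<Longrightarrow> iX ` coz u \<subseteq> ball x \<epsilon>"
proof -
  obtain \<delta> where "\<delta> > 0" "\<forall>u\<in>A. coz (T u) \<subseteq> ball y \<delta> \<longrightarrow> iX ` coz u \<subseteq> ball x \<epsilon>"
    using assms(1)[unfolded psi_at_def, rule_format, OF assms(2)] by (elim exE conjE)
  then show ?thesis
    by (intro that[of \<delta>]) simp_all
qed

lemma phi_at_obtain:
  assumes "phi_at x y" "\<epsilon> > 0"
  obtains \<delta> where "\<delta> > 0" "\<And>u. u \<in> A \<Longrightarrow> iX ` coz u \<subseteq> ball x \<delta> \<Longrightarrow> coz (T u) \<subseteq> ball y \<epsilon>"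
proof -
  obtain \<delta> where "\<delta> > 0" "\<forall>u\<in>A. iX ` coz u \<subseteq> ball x \<delta> \<longrightarrow> coz (T u) \<subseteq> ball y \<epsilon>"
    using assms(1)[unfolded phi_at_def, rule_format, OF assms(2)] by (elim exE conjE)
  then show ?thesis
    by (intro that[of \<delta>]) simp_all
qed

text \<open>
  The preimages \<open>S n\<close> of cozero sets in smaller and smaller balls around \<open>y\<close> shrink. Otherwise (S3)
  or (S4), applied to the preimage \<open>f\<close> of a nonzero constant, produces a \<open>g\<close> such that \<open>T g\<close> must
  coincide with \<open>T f\<close> as well as with \<open>0\<close> at \<open>y\<close>.
\<close>

lemma psi_at_exists: "\<exists>x. psi_at y x"
proof -
  define S where "S n = \<Union>{coz u | u. u \<in> A \<and> coz (T u) \<subseteq> ball y (1 / real (Suc n))}" for n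
  have dec: "S n \<subseteq> S m" if "m \<le> n" for m n
  proof -
    have "1 / real (Suc n) \<le> 1 / real (Suc m)"
      using that by (intro divide_left_mono) auto
    then have "ball y (1 / real (Suc n)) \<subseteq> ball y (1 / real (Suc m))"
      by (rule subset_ball)
    then show ?thesis
      unfolding S_def by blast
  qed
  have ne: "S n \<noteq> {}" for n
  proof -
    obtain u where "u \<in> A" "coz u \<noteq> {}" "coz (T u) \<subseteq> ball y (1 / real (Suc n))"
      by (rule obtain_T_near[of y UNIV "1 / real (Suc n)"]) auto
    then show ?thesis
      unfolding S_def by blast
  qed
  obtain v where v: "v \<noteq> 0" "(\<lambda>y. v) \<in> B"
    using const_B by blast
  obtain f where f: "f \<in> A" "T f = (\<lambda>y. v)"
    by (rule T_onto[OF v(2)])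
  have same_value: "T g y = T h y"
    if gh: "g \<in> A" "h \<in> A" and s: "\<And>n. s n \<in> S n"
      and inf: "\<exists>\<^sub>\<infinity>n. \<exists>C\<in>coz_sets A. s n \<in> C \<and> (\<forall>z\<in>C. g z = h z)" for g h s
  proof -
    have "closed {z. T g z = T h z}"
      using gh by (intro closed_Collect_eq B.continuous T_in)
    moreover have "\<exists>\<^sub>\<infinity>n. \<exists>z\<in>ball y (1 / real (Suc n)). z \<in> {z. T g z = T h z}"
      using inf
    proof (rule frequently_elim1)
      fix n assume "\<exists>C\<in>coz_sets A. s n \<in> C \<and> (\<forall>z\<in>C. g z = h z)"
      then obtain C where C: "C \<in> coz_sets A" "s n \<in> C" "\<And>z. z \<in> C \<Longrightarrow> g z = h z"
        by blast
      obtain u where u: "u \<in> A" "coz (T u) \<subseteq> ball y (1 / real (Suc n))" "s n \<in> coz u"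
        using s[of n] unfolding S_def by blast
      have "open C"
        using C(1) A.coz_open by (auto simp: coz_sets_def)
      then have "\<exists>z\<in>coz (T u). T g z = T h z"
        using agree_in_image[OF gh u(1), of C] C u(3) by blast
      then show "\<exists>z\<in>ball y (1 / real (Suc n)). z \<in> {z. T g z = T h z}"
        using u(2) by blast
    qed
    ultimately have "y \<in> {z. T g z = T h z}"
      by (rule frequently_near_closed)
    then show ?thesis
      by simp
  qed
  have conflict: False
    if g: "g \<in> A" and s: "\<And>n. s n \<in> S n" and t: "\<And>n. t n \<in> S n"
      and f_inf: "\<exists>\<^sub>\<infinity>n. \<exists>C\<in>coz_sets A. s n \<in> C \<and> (\<forall>z\<in>C. g z = f z)"
      and z_inf: "\<exists>\<^sub>\<infinity>n. \<exists>C\<in>coz_sets A. t n \<in> C \<and> (\<forall>z\<in>C. g z = 0)" for g s t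
    using same_value[of g f s, OF g f(1) s f_inf] same_value[of g "\<lambda>x. 0" t, OF g A.zero t z_inf] f(2) v(1)
    by (simp add: T_zero)
  have separated: "\<exists>m n. m \<noteq> n \<and> dist (s m) (s n) < \<delta>" if s: "\<And>n. s n \<in> S n" and "\<delta> > 0" for s \<delta>
  proof (rule ccontr)
    assume "\<not> ?thesis"
    then have sep: "\<exists>\<delta>>0. \<forall>n m. n \<noteq> m \<longrightarrow> \<delta> \<le> dist (s n) (s m)"
      using \<open>\<delta> > 0\<close> by (meson not_less)
    obtain C g where C: "g \<in> A" "\<forall>n. C n \<in> coz_sets A \<and> s n \<in> C n"
      and inf: "\<exists>\<^sub>\<infinity>n. \<forall>z\<in>C n. g z = f z" "\<exists>\<^sub>\<infinity>n. \<forall>z\<in>C n. g z = 0"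
      using S3[unfolded standard_S3_def, rule_format, OF f(1) sep] by (elim exE bexE conjE)
    have "\<exists>\<^sub>\<infinity>n. \<exists>C\<in>coz_sets A. s n \<in> C \<and> (\<forall>z\<in>C. g z = f z)"
      using inf(1) by (rule frequently_elim1) (use C(2) in blast)
    moreover have "\<exists>\<^sub>\<infinity>n. \<exists>C\<in>coz_sets A. s n \<in> C \<and> (\<forall>z\<in>C. g z = 0)"
      using inf(2) by (rule frequently_elim1) (use C(2) in blast)
    ultimately show False
      by (rule conflict[OF C(1) s s])
  qed
  have Cauchy_pair: "\<exists>m n. dist (s m) (t n) < \<delta>"
    if s: "\<And>n. s n \<in> S n" and t: "\<And>n. t n \<in> S n" and C: "Cauchy s" "Cauchy t" and "\<delta> > 0" for s t \<delta>
  proof (rule ccontr)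
    assume "\<not> ?thesis"
    then have sep: "\<exists>\<delta>>0. \<forall>m n. \<delta> \<le> dist (s m) (t n)"
      using \<open>\<delta> > 0\<close> by (meson not_less)
    obtain U V g where g: "U \<in> coz_sets A" "V \<in> coz_sets A" "g \<in> A"
        "\<forall>z\<in>U. g z = f z" "\<forall>z\<in>V. g z = 0"
      and inf: "\<exists>\<^sub>\<infinity>n. s n \<in> U \<and> t n \<in> V"
      using S4[unfolded standard_S4_def, rule_format, OF f(1) C sep] by (elim bexE conjE)
    have "\<exists>\<^sub>\<infinity>n. \<exists>C\<in>coz_sets A. s n \<in> C \<and> (\<forall>z\<in>C. g z = f z)"
      using inf by (rule frequently_elim1) (use g in blast)
    moreover have "\<exists>\<^sub>\<infinity>n. \<exists>C\<in>coz_sets A. t n \<in> C \<and> (\<forall>z\<in>C. g z = 0)"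
      using inf by (rule frequently_elim1) (use g in blast)
    ultimately show False
      by (rule conflict[OF g(3) s t])
  qed
  have small: "\<exists>n. \<forall>x\<in>S n. \<forall>z\<in>S n. dist x z < \<epsilon>" if "\<epsilon> > 0" for \<epsilon>
    using dec separated Cauchy_pair that by (rule decreasing_sets_small)
  have "\<forall>n. \<exists>a. a \<in> S n"
    using ne by blast
  then obtain s where s: "\<And>n. s n \<in> S n"
    by metis
  have sS: "s m \<in> S n" if "m \<ge> n" for m n
    using s[of m] dec[OF that] by blast
  have "Cauchy (\<lambda>n. iX (s n))"
    unfolding Cauchy_def dist_iX using small sS by meson
  then obtain x where x: "(\<lambda>n. iX (s n)) \<longlonglongrightarrow> x"
    using Cauchy_convergent convergent_def by blast
  have "\<exists>\<delta>>0. \<forall>u\<in>A. coz (T u) \<subseteq> ball y \<delta> \<longrightarrow> iX ` coz u \<subseteq> ball x \<epsilon>" if "\<epsilon> > 0" for \<epsilon>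
  proof -
    obtain n where n: "\<And>a b. a \<in> S n \<Longrightarrow> b \<in> S n \<Longrightarrow> dist a b < \<epsilon> / 2"
      using small[of "\<epsilon> / 2"] \<open>\<epsilon> > 0\<close> by auto
    have "dist x (iX a) < \<epsilon>" if a: "a \<in> S n" for a
    proof -
      have "(\<lambda>m. dist (iX (s m)) (iX a)) \<longlonglongrightarrow> dist x (iX a)"
        by (intro tendsto_intros x)
      moreover have "\<forall>\<^sub>F m in sequentially. dist (iX (s m)) (iX a) \<le> \<epsilon> / 2"
        unfolding dist_iX eventually_sequentially using n[OF sS a] less_imp_le by blast
      ultimately have "dist x (iX a) \<le> \<epsilon> / 2"
        by (intro tendsto_upperbound) auto
      then show ?thesis
        using \<open>\<epsilon> > 0\<close> by linarith
    qed
    then have "iX ` S n \<subseteq> ball x \<epsilon>"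
      by auto
    then have "\<forall>u\<in>A. coz (T u) \<subseteq> ball y (1 / real (Suc n)) \<longrightarrow> iX ` coz u \<subseteq> ball x \<epsilon>"
      unfolding S_def by blast
    then show ?thesis
      by (intro exI[of _ "1 / real (Suc n)"]) simp
  qed
  then show ?thesis
    unfolding psi_at_def by blast
qed

text \<open>
  The limit exists in \<open>Y\<close> although \<open>Y\<close> need not be complete: any two disjoint closed subsets of \<open>Y\<close>,
  not only two points of its completion, can be separated by cutoffs in \<open>B\<close>.
\<close>

lemma phi_at_exists: "\<exists>y. phi_at x y"
proof -
  define S where "S n = \<Union>{coz (T u) | u. u \<in> A \<and> iX ` coz u \<subseteq> ball x (1 / real (Suc n))}" for n
  have dec: "S n \<subseteq> S m" if "m \<le> n" for m n
  proof -
    have "1 / real (Suc n) \<le> 1 / real (Suc m)"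
      using that by (intro divide_left_mono) auto
    then have "ball x (1 / real (Suc n)) \<subseteq> ball x (1 / real (Suc m))"
      by (rule subset_ball)
    then show ?thesis
      unfolding S_def by blast
  qed
  have ne: "S n \<noteq> {}" for n
  proof -
    obtain u where "u \<in> A" "coz u \<noteq> {}" "iX ` coz u \<subseteq> ball x (1 / real (Suc n))"
      by (rule obtain_near[of x UNIV "1 / real (Suc n)"]) (auto simp: dense_iX)
    then show ?thesis
      using coz_T_empty_iff[of u] unfolding S_def by blast
  qed
  obtain c where c: "c \<noteq> 0" "(\<lambda>x. c) \<in> A"
    using const_A by blast
  have no_split: "\<exists>n. S n \<inter> P = {} \<or> S n \<inter> Q = {}" if PQ: "closed P" "closed Q" "P \<inter> Q = {}" for P Q
  proof (rule ccontr)
    assume "\<not> ?thesis"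
    then have meets: "\<And>n. S n \<inter> P \<noteq> {}" "\<And>n. S n \<inter> Q \<noteq> {}"
      by blast+
    then have "P \<noteq> {}" "Q \<noteq> {}"
      by blast+
    then obtain k U V where k: "continuous_on UNIV k" "\<And>z. norm (k z) \<le> norm (T (\<lambda>x. c) z)"
      and UV: "open U" "open V" "P - Q \<subseteq> U" "Q - P \<subseteq> V"
      and eq: "\<And>z. z \<in> U \<Longrightarrow> k z = T (\<lambda>x. c) z" "\<And>z. z \<in> V \<Longrightarrow> k z = 0"
      using glue_with_zero[OF PQ(1,2) _ _ B.continuous[OF T_in[OF c(2)]]] PQ(3) by (metis empty_iff)
    obtain h where h: "h \<in> A" "T h = k"
      by (rule T_onto[OF dominated[OF T_in[OF c(2)] k]])
    have near: "\<exists>a. dist (iX a) x < 1 / real (Suc n) \<and> h a = g a"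
      if "g \<in> A" "open W" "S n \<inter> W \<noteq> {}" "\<And>z. z \<in> W \<Longrightarrow> T h z = T g z" for n g W
    proof -
      obtain u where u: "u \<in> A" "iX ` coz u \<subseteq> ball x (1 / real (Suc n))" "coz (T u) \<inter> W \<noteq> {}"
        using \<open>S n \<inter> W \<noteq> {}\<close> unfolding S_def by blast
      then show ?thesis
        using agree_in_preimage[OF h(1) that(1) u(1) that(2) u(3) that(4)] by (force simp: dist_commute)
    qed
    obtain d where d: "d > 0" "\<And>a b. dist a b < d \<Longrightarrow> dist (h a) (h b) < norm c"
      using uniform[OF h(1)] c(1) unfolding uniformly_continuous_on_def
      by (metis UNIV_I zero_less_norm_iff)
    obtain n where n: "1 / real (Suc n) < d / 2"
      using nat_approx_posE[of "d / 2"] d(1) by auto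
    obtain a where a: "dist (iX a) x < 1 / real (Suc n)" "h a = c"
      using near[OF c(2) UV(1), of n] meets(1)[of n] UV(3) PQ(3) eq(1) h(2) by blast
    obtain b where b: "dist (iX b) x < 1 / real (Suc n)" "h b = 0"
      using near[OF A.zero UV(2), of n] meets(2)[of n] UV(4) PQ(3) eq(2) h(2) T_zero by auto
    have "dist (iX a) (iX b) < d"
      using dist_triangle2[of "iX a" "iX b" x] a(1) b(1) n by linarith
    then show False
      using d(2)[of a b] a(2) b(2) by (simp add: dist_iX)
  qed
  obtain y where y: "\<And>\<epsilon>. \<epsilon> > 0 \<Longrightarrow> \<exists>n. S n \<subseteq> ball y \<epsilon>"
    using decreasing_sets_converge[OF dec ne no_split] by blast
  have "\<exists>\<delta>>0. \<forall>u\<in>A. iX ` coz u \<subseteq> ball x \<delta> \<longrightarrow> coz (T u) \<subseteq> ball y \<epsilon>" if \<epsilon>: "\<epsilon> > 0" for \<epsilon>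
  proof -
    obtain n where "S n \<subseteq> ball y \<epsilon>"
      using y[OF \<epsilon>] by blast
    then have "\<forall>u\<in>A. iX ` coz u \<subseteq> ball x (1 / real (Suc n)) \<longrightarrow> coz (T u) \<subseteq> ball y \<epsilon>"
      unfolding S_def by blast
    then show ?thesis
      by (intro exI[of _ "1 / real (Suc n)"]) simp
  qed
  then show ?thesis
    unfolding phi_at_def by blast
qed

text \<open>
  A cozero set near \<open>y\<close> has a preimage near \<open>x\<close>, which is sent near \<open>y'\<close>; being nonempty, it
  leaves no room between \<open>y\<close> and \<open>y'\<close>.
\<close>

lemma phi_at_psi_at_unique:
  assumes "psi_at y x" "phi_at x y'"
  shows "y' = y"
proof (rule ccontr)
  assume "y' \<noteq> y"
  then have r: "dist y y' / 2 > 0" (is "?r > 0")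
    by simp
  obtain \<delta> where \<delta>: "\<delta> > 0" "\<And>u. u \<in> A \<Longrightarrow> iX ` coz u \<subseteq> ball x \<delta> \<Longrightarrow> coz (T u) \<subseteq> ball y' ?r"
    by (rule phi_at_obtain[OF assms(2) r]) blast
  obtain \<eta> where \<eta>: "\<eta> > 0" "\<And>u. u \<in> A \<Longrightarrow> coz (T u) \<subseteq> ball y \<eta> \<Longrightarrow> iX ` coz u \<subseteq> ball x \<delta>"
    by (rule psi_at_obtain[OF assms(1) \<delta>(1)]) blast
  obtain u where u: "u \<in> A" "coz (T u) \<noteq> {}" "coz (T u) \<subseteq> ball y (min \<eta> ?r)"
    by (rule obtain_T_near[of y UNIV "min \<eta> ?r"]) (use r \<eta>(1) in auto)
  have "coz (T u) \<subseteq> ball y \<eta>"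
    using u(3) by auto
  then have "coz (T u) \<subseteq> ball y' ?r"
    by (intro \<delta>(2) \<eta>(2) u(1))
  then obtain z where "z \<in> ball y (min \<eta> ?r)" "z \<in> ball y' ?r"
    using u(2,3) by blast
  then show False
    using dist_triangle2[of y y' z] by simp
qed

lemma psi_at_phi_at_unique:
  assumes "phi_at x y" "psi_at y x'"
  shows "x' = x"
proof (rule ccontr)
  assume "x' \<noteq> x"
  then have r: "dist x x' / 2 > 0" (is "?r > 0")
    by simp
  obtain \<delta> where \<delta>: "\<delta> > 0" "\<And>u. u \<in> A \<Longrightarrow> coz (T u) \<subseteq> ball y \<delta> \<Longrightarrow> iX ` coz u \<subseteq> ball x' ?r"
    by (rule psi_at_obtain[OF assms(2) r]) blast
  obtain \<eta> where \<eta>: "\<eta> > 0" "\<And>u. u \<in> A \<Longrightarrow> iX ` coz u \<subseteq> ball x \<eta> \<Longrightarrow> coz (T u) \<subseteq> ball y \<delta>"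
    by (rule phi_at_obtain[OF assms(1) \<delta>(1)]) blast
  obtain u where u: "u \<in> A" "coz u \<noteq> {}" "iX ` coz u \<subseteq> ball x (min \<eta> ?r)"
    by (rule obtain_near[of x UNIV "min \<eta> ?r"]) (use r \<eta>(1) dense_iX in auto)
  have "iX ` coz u \<subseteq> ball x \<eta>"
    using u(3) by auto
  then have "iX ` coz u \<subseteq> ball x' ?r"
    by (intro \<delta>(2) \<eta>(2) u(1))
  then obtain z where "z \<in> ball x (min \<eta> ?r)" "z \<in> ball x' ?r"
    using u(2,3) by blast
  then show False
    using dist_triangle2[of x x' z] by simp
qed

lemma psi_at_iff_phi_at: "psi_at y x \<longleftrightarrow> phi_at x y"
  using phi_at_exists[of x] psi_at_exists[of y] phi_at_psi_at_unique psi_at_phi_at_unique by blast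

text \<open>
  As the associated point is defined by a definite description, both the convergence along
  all sequences and the existence of at least one sequence enter.
\<close>

lemma assoc_psi_eq:
  assumes "psi_at y x"
  shows "assoc_psi iX A B T y = x"
  unfolding assoc_psi_def
proof (rule the_equality)
  show lim: "\<forall>V xs. shrinks_to id B V y \<longrightarrow> (\<forall>n. xs n \<in> theta_inv A B T (closure (V n))) \<longrightarrow>
      (\<lambda>n. iX (xs n)) \<longlonglongrightarrow> x"
  proof (intro allI impI)
    fix V xs assume V: "shrinks_to id B V y" and xs: "\<forall>n. xs n \<in> theta_inv A B T (closure (V n))"
    show "(\<lambda>n. iX (xs n)) \<longlonglongrightarrow> x"
    proof (rule tendstoI)
      fix e :: real assume "e > 0"
      obtain \<delta> where \<delta>: "\<delta> > 0" "\<And>u. u \<in> A \<Longrightarrow> coz (T u) \<subseteq> ball y \<delta> \<Longrightarrow> iX ` coz u \<subseteq> ball x (e / 2)"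
        by (rule psi_at_obtain[OF assms half_gt_zero[OF \<open>e > 0\<close>]]) blast
      show "\<forall>\<^sub>F n in sequentially. dist (iX (xs n)) x < e"
        using shrinks_to_eventually[OF V \<delta>(1)]
      proof eventually_elim
        case (elim n)
        obtain k where k: "k \<in> B" "V n = coz k"
          using V by (auto simp: shrinks_to_def coz_sets_def)
        obtain u where u: "u \<in> A" "T u = k"
          by (rule T_onto[OF k(1)])
        have "xs n \<in> closure (coz u)"
          using xs[rule_format, of n] theta_inv_closure_coz[OF u(1)] k u by simp
        moreover have "coz u \<subseteq> iX -` cball x (e / 2)"
          using \<delta>(2)[OF u(1)] elim k u ball_subset_cball[of x "e / 2"] by blast
        moreover have "closed (iX -` cball x (e / 2))"
          by (rule closed_vimage[OF closed_cball continuous_iX])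
        ultimately have "dist (iX (xs n)) x \<le> e / 2"
          using closure_minimal[of "coz u" "iX -` cball x (e / 2)"] by (auto simp: dist_commute)
        then show ?case
          using \<open>e > 0\<close> by linarith
      qed
    qed
  qed
  fix x'
  assume x': "\<forall>V xs. shrinks_to id B V y \<longrightarrow> (\<forall>n. xs n \<in> theta_inv A B T (closure (V n))) \<longrightarrow>
      (\<lambda>n. iX (xs n)) \<longlonglongrightarrow> x'"
  obtain V where V: "shrinks_to id B V y"
    using shrinks_to_exists[OF B.function_space_axioms] by blast
  have "\<exists>a. a \<in> theta_inv A B T (closure (V n))" for n
  proof -
    have "V n \<in> coz_sets B" "V n \<noteq> {}"
      using V by (simp_all add: shrinks_to_def)
    then obtain k where k: "k \<in> B" "V n = coz k" "coz k \<noteq> {}"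
      by (auto simp: coz_sets_def)
    obtain u where u: "u \<in> A" "T u = k"
      by (rule T_onto[OF k(1)])
    then show ?thesis
      using theta_inv_closure_coz[OF u(1)] k coz_T_empty_iff[OF u(1)] closure_subset[of "coz u"] by auto
  qed
  then obtain xs where "\<forall>n. xs n \<in> theta_inv A B T (closure (V n))"
    by metis
  then have "(\<lambda>n. iX (xs n)) \<longlonglongrightarrow> x" "(\<lambda>n. iX (xs n)) \<longlonglongrightarrow> x'"
    using lim x' V by blast+
  then show "x' = x"
    using LIMSEQ_unique by blast
qed

lemma assoc_phi_eq:
  assumes "phi_at (iX x) y"
  shows "assoc_phi A B T x = y"
  unfolding assoc_phi_def
proof (rule the_equality)
  show lim: "\<forall>U ys. shrinks_to id A U x \<longrightarrow> (\<forall>n. ys n \<in> theta A B T (closure (U n))) \<longrightarrow> ys \<longlonglongrightarrow> y"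
  proof (intro allI impI)
    fix U ys assume U: "shrinks_to id A U x" and ys: "\<forall>n. ys n \<in> theta A B T (closure (U n))"
    show "ys \<longlonglongrightarrow> y"
    proof (rule tendstoI)
      fix e :: real assume "e > 0"
      obtain \<delta> where \<delta>: "\<delta> > 0" "\<And>u. u \<in> A \<Longrightarrow> iX ` coz u \<subseteq> ball (iX x) \<delta> \<Longrightarrow> coz (T u) \<subseteq> ball y (e / 2)"
        by (rule phi_at_obtain[OF assms half_gt_zero[OF \<open>e > 0\<close>]]) blast
      show "\<forall>\<^sub>F n in sequentially. dist (ys n) y < e"
        using shrinks_to_eventually[OF U \<delta>(1)]
      proof eventually_elim
        case (elim n)
        obtain u where u: "u \<in> A" "U n = coz u"
          using U by (auto simp: shrinks_to_def coz_sets_def)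
        have "ys n \<in> closure (coz (T u))"
          using ys[rule_format, of n] theta_closure_coz[OF u(1)] u by simp
        moreover have "iX ` coz u \<subseteq> ball (iX x) \<delta>"
          using elim u by (auto simp: dist_iX)
        then have "coz (T u) \<subseteq> cball y (e / 2)"
          using \<delta>(2)[OF u(1)] ball_subset_cball[of y "e / 2"] by blast
        ultimately have "dist (ys n) y \<le> e / 2"
          using closure_minimal[of "coz (T u)" "cball y (e / 2)"] by (auto simp: dist_commute)
        then show ?case
          using \<open>e > 0\<close> by linarith
      qed
    qed
  qed
  fix y'
  assume y': "\<forall>U ys. shrinks_to id A U x \<longrightarrow> (\<forall>n. ys n \<in> theta A B T (closure (U n))) \<longrightarrow> ys \<longlonglongrightarrow> y'"
  obtain U where U: "shrinks_to id A U x"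
    using shrinks_to_exists[OF A.function_space_axioms] by blast
  have "\<exists>a. a \<in> theta A B T (closure (U n))" for n
  proof -
    have "U n \<in> coz_sets A" "U n \<noteq> {}"
      using U by (simp_all add: shrinks_to_def)
    then obtain u where u: "u \<in> A" "U n = coz u" "coz u \<noteq> {}"
      by (auto simp: coz_sets_def)
    then show ?thesis
      using theta_closure_coz[OF u(1)] coz_T_empty_iff[OF u(1)] closure_subset[of "coz (T u)"] by auto
  qed
  then obtain ys where "\<forall>n. ys n \<in> theta A B T (closure (U n))"
    by metis
  then have "ys \<longlonglongrightarrow> y" "ys \<longlonglongrightarrow> y'"
    using lim y' U by blast+
  then show "y' = y"
    using LIMSEQ_unique by blast
qed

section \<open>Values at corresponding points\<close>

text \<open>
  The set \<open>W\<close> contains small cozero sets near \<open>x\<close>; on their images, which lie near \<open>y\<close>, the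
  functions \<open>T f\<close> and \<open>T g\<close> agree.
\<close>

lemma agree_at_phi:
  assumes "phi_at x y" and fg: "f \<in> A" "g \<in> A" and W: "open W" "x \<in> closure (iX ` W)"
    and eq: "\<And>z. z \<in> W \<Longrightarrow> f z = g z"
  shows "T f y = T g y"
proof (rule agree_on_closure[where S = "{z. T f z = T g z}"])
  show "continuous_on UNIV (T f)" "continuous_on UNIV (T g)"
    using fg by (simp_all add: B.continuous T_in)
  show "T f z = T g z" if "z \<in> {z. T f z = T g z}" for z
    using that by simp
  show "y \<in> closure {z. T f z = T g z}"
    unfolding closure_approachable
  proof (intro allI impI)
    fix e :: real assume e: "e > 0"
    obtain \<delta> where \<delta>: "\<delta> > 0" "\<And>u. u \<in> A \<Longrightarrow> iX ` coz u \<subseteq> ball x \<delta> \<Longrightarrow> coz (T u) \<subseteq> ball y e"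
      by (rule phi_at_obtain[OF assms(1) e]) blast
    obtain u where u: "u \<in> A" "coz u \<noteq> {}" "coz u \<subseteq> W" "iX ` coz u \<subseteq> ball x \<delta>"
      by (rule obtain_near[OF W(2,1) \<delta>(1)])
    obtain z where z: "z \<in> coz (T u)"
      using u coz_T_empty_iff[OF u(1)] by blast
    moreover have "\<forall>z\<in>coz (T u). T f z = T g z"
      using agree_iff[OF fg u(1)] eq u(3) by blast
    ultimately show "\<exists>z\<in>{z. T f z = T g z}. dist z y < e"
      using \<delta>(2)[OF u(1,4)] by (force simp: dist_commute)
  qed
qed

lemma agree_at_psi:
  assumes "psi_at y (iX x)" and fg: "f \<in> A" "g \<in> A" and W: "open W" "y \<in> closure W"
    and eq: "\<And>z. z \<in> W \<Longrightarrow> T f z = T g z"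
  shows "f x = g x"
proof (rule agree_on_closure[where S = "{z. f z = g z}"])
  show "continuous_on UNIV f" "continuous_on UNIV g"
    using fg by (simp_all add: A.continuous)
  show "f z = g z" if "z \<in> {z. f z = g z}" for z
    using that by simp
  show "x \<in> closure {z. f z = g z}"
    unfolding closure_approachable
  proof (intro allI impI)
    fix e :: real assume e: "e > 0"
    obtain \<delta> where \<delta>: "\<delta> > 0" "\<And>u. u \<in> A \<Longrightarrow> coz (T u) \<subseteq> ball y \<delta> \<Longrightarrow> iX ` coz u \<subseteq> ball (iX x) e"
      by (rule psi_at_obtain[OF assms(1) e]) blast
    obtain u where u: "u \<in> A" "coz u \<noteq> {}" "coz (T u) \<subseteq> W" "coz (T u) \<subseteq> ball y \<delta>"
      by (rule obtain_T_near[OF W(2,1) \<delta>(1)])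
    obtain z where z: "z \<in> coz u"
      using u by blast
    moreover have "\<forall>z\<in>coz u. f z = g z"
      using agree_iff[OF fg u(1)] eq u(3) by blast
    ultimately show "\<exists>z\<in>{z. f z = g z}. dist z x < e"
      using \<delta>(2)[OF u(1,4)] by (force simp: dist_commute dist_iX)
  qed
qed

text \<open>
  For isolated \<open>x\<close> the limit condition is vacuous, so the values at \<open>x\<close> have to be compared
  separately; then \<open>{x}\<close> is open and, by density, contained in the image of \<open>X\<close>.
\<close>

lemma image_value_determined:
  assumes psi: "psi_at y x" and P: "property_P iX A" and fg: "f \<in> A" "g \<in> A"
    and lim: "((\<lambda>z. f z - g z) \<longlongrightarrow> 0) (filtercomap iX (at x))"
    and at: "\<And>z. iX z = x \<Longrightarrow> f z = g z"
  shows "T f y = T g y"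
proof (cases "x islimpt UNIV")
  case True
  have "(\<lambda>z. f z - g z) \<in> A"
    by (rule A.diff[OF fg])
  then obtain U V h where h: "h \<in> A" "open U" "open V" "x \<in> closure (iX ` U)" "x \<in> closure (iX ` V)"
      "\<forall>z\<in>U. h z = f z - g z" "\<forall>z\<in>V. h z = 0"
    using P True lim unfolding property_P_def by (metis (no_types, lifting) IntE)
  have phi: "phi_at x y"
    using psi by (simp add: psi_at_iff_phi_at)
  have gh: "(\<lambda>z. g z + h z) \<in> A"
    by (rule A.add[OF fg(2) h(1)])
  have "T (\<lambda>z. g z + h z) y = T f y"
    by (rule agree_at_phi[OF phi gh fg(1) h(2,4)]) (use h(6) in simp)
  moreover have "T (\<lambda>z. g z + h z) y = T g y"
    by (rule agree_at_phi[OF phi gh fg(2) h(3,5)]) (use h(7) in simp)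
  ultimately show ?thesis
    by simp
next
  case False
  then have "open {x}"
    by (simp add: islimpt_UNIV_iff)
  then have "open (iX -` {x})"
    by (rule open_vimage_iX)
  moreover have "x \<in> closure (iX ` (iX -` {x}))"
  proof -
    have "{x} \<inter> closure (range iX) \<noteq> {}"
      using dense_iX by blast
    then have "x \<in> range iX"
      using open_disjoint_closure[OF \<open>open {x}\<close>] by blast
    then show ?thesis
      using closure_subset by fastforce
  qed
  ultimately show ?thesis
    using agree_at_phi[of x y f g "iX -` {x}"] psi fg at by (simp add: psi_at_iff_phi_at)
qed

text \<open>
  At a limit point \<open>y\<close>, the even and the odd members of an injective sequence converging to \<open>y\<close>
  give two closed sets that meet only in \<open>y\<close>. Cutting off \<open>T f - T g\<close> between them yields a function
  in \<open>B\<close> that agrees with \<open>T f\<close> and with \<open>T g\<close> on open sets accumulating at \<open>y\<close>.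
\<close>

lemma preimage_value_determined:
  assumes psi: "psi_at y (iX x)" and fg: "f \<in> A" "g \<in> A" and eq: "T f y = T g y"
  shows "f x = g x"
proof (cases "y islimpt UNIV")
  case True
  then obtain s :: "nat \<Rightarrow> 'y" where s: "\<And>n. s n \<noteq> y" "inj s" "s \<longlonglongrightarrow> y"
    by (rule limit_point_injective_sequence) blast
  define P Q where "P = insert y (range (\<lambda>n. s (2 * n)))" and "Q = insert y (range (\<lambda>n. s (2 * n + 1)))"
  have sub: "(\<lambda>n. s (2 * n)) \<longlonglongrightarrow> y" "(\<lambda>n. s (2 * n + 1)) \<longlonglongrightarrow> y"
    using LIMSEQ_subseq_LIMSEQ[OF s(3), of "\<lambda>n. 2 * n"] LIMSEQ_subseq_LIMSEQ[OF s(3), of "\<lambda>n. 2 * n + 1"]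
    by (simp_all add: strict_mono_def o_def)
  have closed: "closed P" "closed Q"
    unfolding P_def Q_def by (intro closed_insert_limit sub)+
  have parity: "2 * m \<noteq> 2 * n + 1" for m n :: nat
    by presburger
  have PQ: "P \<inter> Q = {y}"
    using parity injD[OF s(2)] by (fastforce simp: P_def Q_def)
  have tails: "s (2 * n) \<in> P - Q" "s (2 * n + 1) \<in> Q - P" for n
    using PQ s(1) by (auto simp: P_def Q_def)
  have "(\<lambda>z. T f z - T g z) \<in> B"
    by (rule B.diff[OF T_in[OF fg(1)] T_in[OF fg(2)]])
  note d = this
  obtain k U V where k: "continuous_on UNIV k" "\<And>z. norm (k z) \<le> norm (T f z - T g z)"
    and UV: "open U" "open V" "P - Q \<subseteq> U" "Q - P \<subseteq> V"
    and on: "\<And>z. z \<in> U \<Longrightarrow> k z = T f z - T g z" "\<And>z. z \<in> V \<Longrightarrow> k z = 0"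
    by (rule glue_with_zero[OF closed _ _ B.continuous[OF d]]) (use PQ eq in auto)
  have "(\<lambda>z. T g z + k z) \<in> B"
    by (rule B.add[OF T_in[OF fg(2)] dominated[OF d k]])
  then obtain h where h: "h \<in> A" "T h = (\<lambda>z. T g z + k z)"
    by (rule T_onto)
  have in_UV: "\<forall>n. s (2 * n) \<in> U" "\<forall>n. s (2 * n + 1) \<in> V"
    using tails UV(3,4) by blast+
  have cl: "y \<in> closure U" "y \<in> closure V"
    unfolding closure_sequential
    by (rule exI, rule conjI[OF in_UV(1) sub(1)], rule exI, rule conjI[OF in_UV(2) sub(2)])
  have "h x = f x"
    by (rule agree_at_psi[OF psi h(1) fg(1) UV(1) cl(1)]) (simp add: h(2) on(1))
  moreover have "h x = g x"
    by (rule agree_at_psi[OF psi h(1) fg(2) UV(2) cl(2)]) (simp add: h(2) on(2))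
  ultimately show ?thesis
    by simp
next
  case False
  then have "open {y}"
    by (simp add: islimpt_UNIV_iff)
  then show ?thesis
    using agree_at_psi[OF psi fg, of "{y}"] eq by simp
qed

end

section \<open>Standard spaces, spaces of continuous functions, and extensions\<close>

lemma function_space_standard:
  assumes "standard_space A"
  shows "function_space A"
proof
  show "fun_subspace A" "f \<in> A \<Longrightarrow> continuous_on UNIV f" for f
    using assms by (auto simp: standard_space_def)
  fix W and x :: 'a
  assume "open W" "x \<in> W"
  then obtain e where e: "e > 0" "ball x e \<subseteq> W"
    using open_contains_ball by blast
  have "standard_S2 A"
    using assms by (simp add: standard_space_def)
  then obtain C where C: "C \<in> coz_sets A" "x \<in> C" "bounded C" "diameter C < e"
    using e(1) unfolding standard_S2_def by blast
  have "C \<subseteq> ball x e"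
  proof
    fix z assume "z \<in> C"
    then have "dist x z \<le> diameter C"
      using C by (intro diameter_bounded_bound)
    then show "z \<in> ball x e"
      using C(4) by simp
  qed
  then show "\<exists>h\<in>A. x \<in> coz h \<and> coz h \<subseteq> W"
    using C(1,2) e(2) unfolding coz_sets_def by blast
qed

lemma function_space_continuous:
  fixes B :: "('y::metric_space \<Rightarrow> 'f::real_normed_vector) set"
  assumes B: "B = {g. continuous_on UNIV g} \<or> B = {g. continuous_on UNIV g \<and> bounded (range g)}"
    and v: "v \<noteq> (0::'f)"
  shows "function_space B"
proof
  show "fun_subspace B"
    using B unfolding fun_subspace_def
    by (auto intro!: continuous_intros bounded_plus_comp bounded_scaleR_comp)
  show "f \<in> B \<Longrightarrow> continuous_on UNIV f" for f
    using B by auto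
  fix W and y :: 'y
  assume "open W" "y \<in> W"
  then obtain r where r: "r > 0" "ball y r \<subseteq> W"
    using open_contains_ball by blast
  define h where "h z = max 0 (r - dist y z) *\<^sub>R v" for z
  have "continuous_on UNIV h"
    unfolding h_def by (intro continuous_intros)
  moreover have "bounded (range h)"
    unfolding h_def by (rule boundedI[of _ "r * norm v"]) (auto intro!: mult_right_mono r(1)[THEN less_imp_le])
  ultimately have "h \<in> B"
    using B by auto
  moreover have "y \<in> coz h" "coz h \<subseteq> W"
    using r v by (auto simp: h_def coz_def max_def split: if_splits)
  ultimately show "\<exists>h\<in>B. y \<in> coz h \<and> coz h \<subseteq> W"
    by blast
qed

lemma extend_continuous:
  assumes i: "is_completion i" and j: "is_completion j" and f: "uniformly_continuous_on UNIV f"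
  shows "continuous_on UNIV (extend i j f)" "extend i j f (i x) = j (f x)"
proof -
  note di = completion_dist[OF i] and dj = completion_dist[OF j]
  have inj: "inj i"
    by (metis di dist_eq_0_iff injI)
  define k where "k p = j (f (inv i p))" for p
  have k: "k (i x) = j (f x)" for x
    by (simp add: k_def inv_f_f[OF inj])
  have "uniformly_continuous_on (range i) k"
    using f unfolding uniformly_continuous_on_def by (auto simp: k di dj)
  then obtain g where g: "uniformly_continuous_on (closure (range i)) g" "\<And>p. p \<in> range i \<Longrightarrow> k p = g p"
    and unique: "\<And>Y h x. range i \<subseteq> Y \<Longrightarrow> Y \<subseteq> closure (range i) \<Longrightarrow> continuous_on Y h \<Longrightarrow>
      (\<And>x. x \<in> range i \<Longrightarrow> k x = h x) \<Longrightarrow> x \<in> Y \<Longrightarrow> h x = g x"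
    by (rule uniformly_continuous_on_extension_on_closure) blast
  have dense: "closure (range i) = UNIV"
    using i by (simp add: is_completion_def)
  have "extend i j f = g"
    unfolding extend_def
  proof (rule the_equality)
    show "continuous_on UNIV g \<and> (\<forall>x. g (i x) = j (f x))"
      using g dense uniformly_continuous_imp_continuous k by (metis rangeI)
    show "h = g" if "continuous_on UNIV h \<and> (\<forall>x. h (i x) = j (f x))" for h
      by (rule ext, rule unique[of UNIV h]) (use that dense k in auto)
  qed
  then show "continuous_on UNIV (extend i j f)" "extend i j f (i x) = j (f x)"
    using g dense uniformly_continuous_imp_continuous k by (metis rangeI)+
qed

text \<open>
  Equality of the extensions at one point in the form required by property (P), which speaks about
  the functions themselves.
\<close>

lemma extend_eq_imp_tendsto:
  fixes f g :: "'x::metric_space \<Rightarrow> 'e::real_normed_vector"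
  assumes i: "is_completion i" and j: "is_completion j"
    and f: "uniformly_continuous_on UNIV f" and g: "uniformly_continuous_on UNIV g"
    and eq: "extend i j f x = extend i j g x"
  shows "((\<lambda>z. f z - g z) \<longlongrightarrow> 0) (filtercomap i (at x))"
proof (rule tendsto_norm_zero_cancel)
  let ?d = "\<lambda>p. dist (extend i j f p) (extend i j g p)"
  have "(extend i j f \<longlongrightarrow> extend i j f x) (at x)" "(extend i j g \<longlongrightarrow> extend i j g x) (at x)"
    using extend_continuous(1)[OF i j f] extend_continuous(1)[OF i j g] by (simp_all add: continuous_on_def)
  then have "(?d \<longlongrightarrow> 0) (at x)"
    using tendsto_dist[of "extend i j f" _ "at x" "extend i j g"] eq by fastforce
  then have "((\<lambda>z. ?d (i z)) \<longlongrightarrow> 0) (filtercomap i (at x))"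
    by (rule filterlim_compose[OF _ filterlim_filtercomap])
  then show "((\<lambda>z. norm (f z - g z)) \<longlongrightarrow> 0) (filtercomap i (at x))"
    by (simp add: extend_continuous(2)[OF i j f] extend_continuous(2)[OF i j g] completion_dist[OF j] dist_norm)
qed

theorem proposition5p4:
  fixes iX :: "'x::metric_space \<Rightarrow> 'xc::complete_space"
    and iE :: "'e::real_normed_vector \<Rightarrow> 'ec::complete_space"
    and A :: "('x \<Rightarrow> 'e) set"
    and B :: "('y::metric_space \<Rightarrow> 'f::real_normed_vector) set"
    and T :: "('x \<Rightarrow> 'e) \<Rightarrow> ('y \<Rightarrow> 'f)"
    and \<phi> :: "'x \<Rightarrow> 'y" and \<psi> :: "'y \<Rightarrow> 'xc"
  assumes complX: "is_completion iX" and complE: "is_completion iE"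
    and E_nontrivial: "\<exists>e::'e. e \<noteq> 0" and F_nontrivial: "\<exists>v::'f. v \<noteq> 0"
    and A_standard: "standard_space A"
    and A_unif: "\<forall>f\<in>A. uniformly_continuous_on UNIV f"
    and A_const: "\<exists>c. c \<noteq> 0 \<and> (\<lambda>x. c) \<in> A"
    and A_P: "property_P iX A"
    and B_def: "B = {g. continuous_on UNIV g} \<or> B = {g. continuous_on UNIV g \<and> bounded (range g)}"
    and T_bisep: "biseparating A B T"
    and T_zero: "T (\<lambda>x. 0) = (\<lambda>y. 0)"
    and phi: "\<phi> = assoc_phi A B T"
    and psi: "\<psi> = assoc_psi iX A B T"
  shows "(\<forall>y. \<exists>\<Phi> \<in> ext_values iX iE A (\<psi> y) \<rightarrow>\<^sub>E (UNIV :: 'f set).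
            \<forall>f\<in>A. T f y = \<Phi> (extend iX iE f (\<psi> y)))
       \<and> (\<exists>\<Psi> :: 'x \<times> 'f \<Rightarrow> 'e. \<forall>g\<in>B. \<forall>x. inv_into A T g x = \<Psi> (x, g (\<phi> x)))"
proof -
  obtain v :: 'f where v: "v \<noteq> 0"
    using F_nontrivial by blast
  interpret A: function_space A
    by (rule function_space_standard[OF A_standard])
  interpret B: function_space B
    by (rule function_space_continuous[OF B_def v])
  interpret biseparating_uniform_map A B T iX
  proof
    show "biseparating A B T" "T (\<lambda>x. 0) = (\<lambda>y. 0)" "is_completion iX"
      by fact+
    show "standard_S3 A" "standard_S4 A"
      using A_standard by (simp_all add: standard_space_def)
    show "\<exists>c. c \<noteq> 0 \<and> (\<lambda>x. c) \<in> A"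
      by fact
    show "uniformly_continuous_on UNIV f" if "f \<in> A" for f
      using A_unif that by blast
    have "(\<lambda>y. v) \<in> B"
      using B_def by auto
    then show "\<exists>v. v \<noteq> 0 \<and> (\<lambda>y. v) \<in> B"
      using v by blast
    show "g \<in> B" if "d \<in> B" "continuous_on UNIV g" "\<And>z. norm (g z) \<le> norm (d z)" for d g
    proof -
      have "bounded (range g)" if "bounded (range d)"
      proof -
        obtain b where "\<And>z. norm (d z) \<le> b"
          using \<open>bounded (range d)\<close> unfolding bounded_iff by blast
        then have "\<And>z. norm (g z) \<le> b"
          using \<open>\<And>z. norm (g z) \<le> norm (d z)\<close> order_trans by blast
        then show ?thesis
          by (intro boundedI[of _ b]) auto
      qed
      then show ?thesis
        using B_def that(1,2) by auto
    qed
    show "\<exists>g\<in>A. \<exists>W. open W \<and> x \<in> W \<and> (\<forall>z\<in>W. g z = f z) \<and> (\<forall>z\<in>closure (coz u). g z = 0)"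
      if f: "f \<in> A" and u: "u \<in> A" and x: "x \<notin> closure (coz u)" for f u x
    proof -
      have D: "closure (coz u) \<in> hat_coz_sets A"
        unfolding hat_coz_sets_def using u A.hat_coz_eq_closure by blast
      have "standard_S1 A"
        using A_standard by (simp add: standard_space_def)
      from this[unfolded standard_S1_def, rule_format, OF f D x]
      obtain g C where "g \<in> A" "C \<in> coz_sets A" "x \<in> C" "\<forall>z\<in>C. g z = f z" "\<forall>z\<in>closure (coz u). g z = 0"
        by (elim bexE conjE)
      moreover have "open C"
        using \<open>C \<in> coz_sets A\<close> A.coz_open by (auto simp: coz_sets_def)
      ultimately show ?thesis
        by blast
    qed
  qed
  have "\<exists>\<Phi> \<in> ext_values iX iE A (\<psi> y) \<rightarrow>\<^sub>E (UNIV :: 'f set). \<forall>f\<in>A. T f y = \<Phi> (extend iX iE f (\<psi> y))" for y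
  proof -
    have at: "psi_at y (\<psi> y)"
      using psi_at_exists[of y] assoc_psi_eq unfolding psi by metis
    have same: "T f y = T g y"
      if f: "f \<in> A" and g: "g \<in> A" and eq: "extend iX iE f (\<psi> y) = extend iX iE g (\<psi> y)" for f g
    proof (rule image_value_determined[OF at A_P f g])
      show "((\<lambda>z. f z - g z) \<longlongrightarrow> 0) (filtercomap iX (at (\<psi> y)))"
        by (rule extend_eq_imp_tendsto[OF complX complE uniform[OF f] uniform[OF g] eq])
      fix z assume "iX z = \<psi> y"
      then have "iE (f z) = iE (g z)"
        using eq extend_continuous(2)[OF complX complE uniform[OF f], of z]
          extend_continuous(2)[OF complX complE uniform[OF g], of z] by simp
      then show "f z = g z"
        by (metis completion_dist[OF complE] dist_eq_0_iff)
    qed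
    define \<Phi> where "\<Phi> = restrict (\<lambda>w. T (SOME f. f \<in> A \<and> extend iX iE f (\<psi> y) = w) y)
      (ext_values iX iE A (\<psi> y))"
    have "T f y = \<Phi> (extend iX iE f (\<psi> y))" if f: "f \<in> A" for f
    proof -
      let ?g = "SOME g. g \<in> A \<and> extend iX iE g (\<psi> y) = extend iX iE f (\<psi> y)"
      have "?g \<in> A \<and> extend iX iE ?g (\<psi> y) = extend iX iE f (\<psi> y)"
        by (rule someI[of _ f]) (simp add: f)
      then have "T ?g y = T f y"
        using same f by blast
      moreover have "extend iX iE f (\<psi> y) \<in> ext_values iX iE A (\<psi> y)"
        using f by (auto simp: ext_values_def)
      ultimately show ?thesis
        by (simp add: \<Phi>_def)
    qed
    moreover have "\<Phi> \<in> ext_values iX iE A (\<psi> y) \<rightarrow>\<^sub>E UNIV"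
      by (simp add: \<Phi>_def)
    ultimately show ?thesis
      by blast
  qed
  moreover have "\<exists>\<Psi> :: 'x \<times> 'f \<Rightarrow> 'e. \<forall>g\<in>B. \<forall>x. inv_into A T g x = \<Psi> (x, g (\<phi> x))"
  proof -
    have TA: "T ` A = B"
      using T_bisep by (simp add: biseparating_def bij_betw_def)
    have inv: "inv_into A T g \<in> A" "T (inv_into A T g) = g" if "g \<in> B" for g
      using that inv_into_into[of g T A] f_inv_into_f[of g T A] unfolding TA by blast+
    have same: "inv_into A T g x = inv_into A T h x"
      if g: "g \<in> B" and h: "h \<in> B" and eq: "g (\<phi> x) = h (\<phi> x)" for g h x
    proof -
      have "phi_at (iX x) (\<phi> x)"
        using phi_at_exists[of "iX x"] assoc_phi_eq unfolding phi by metis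
      then have at: "psi_at (\<phi> x) (iX x)"
        by (simp add: psi_at_iff_phi_at)
      show ?thesis
        by (rule preimage_value_determined[OF at inv(1)[OF g] inv(1)[OF h]])
          (simp add: inv(2)[OF g] inv(2)[OF h] eq)
    qed
    define \<Psi> where "\<Psi> p = inv_into A T (SOME g. g \<in> B \<and> g (\<phi> (fst p)) = snd p) (fst p)" for p
    have "inv_into A T g x = \<Psi> (x, g (\<phi> x))" if g: "g \<in> B" for g x
    proof -
      let ?h = "SOME h. h \<in> B \<and> h (\<phi> x) = g (\<phi> x)"
      have "?h \<in> B \<and> ?h (\<phi> x) = g (\<phi> x)"
        by (rule someI[of _ g]) (simp add: g)
      then have "inv_into A T g x = inv_into A T ?h x"
        using same[OF g] by metis
      then show ?thesis
        by (simp add: \<Psi>_def)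
    qed
    then show ?thesis
      by blast
  qed
  ultimately show ?thesis
    by blast
qed

end
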